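(* For every $q\in\mathbb{N}$, the number of members (up to isomorphism) of $\mathcal{O}$ whose palette is a subset of $[q]=\{1,\dots,q\}$ is $$|\mathcal{O}_{[q]}|=\frac{1}{24}\left(3q^4-14q^3+129q^2-22q+48\right).$$
   Context: Graphs are finite and simple. Colors are positive integers. A colorful graph is a pair $(G,\chi)$ where $G$ is a graph and $\chi$ maps each vertex to a finite (possibly empty) set of colors (its palette); the palette of $(G,\chi)$ is $\bigcup_{v\in V(G)}\chi(v)$. Two colorful graphs are isomorphic if there is a graph isomorphism preserving the palettes of vertices exactly (colors are not permuted). $K_5^-$ and $K_{3,3}^-$ denote $K_5$ and $K_{3,3}$ minus one edge. $\mathcal{O}=\mathcal{O}^0\cup\tilde{\mathcal{O}}^1\cup\tilde{\mathcal{O}}^2\cup\mathcal{O}^3\cup\mathcal{O}^4$, where: - $\mathcal{O}^0$: $K_5$ and $K_{3,3}$ with all palettes empty. - $\mathcal{O}^1$: all colorful graphs of the following forms: $K_5^-$ where each of the two degree-3 vertices carries exactly one color and the others none; $K_4$ where each vertex carries exactly one color; $K_{3,3}^-$ where each of the two degree-2 vertices carries exactly one color and the others none; $K_{2,3}$ where each of the three degree-2 vertices carries exactly one color and the others none (colors on different vertices may coincide or differ). - $\tilde{\mathcal{O}}^1$: the members of $\mathcal{O}^1$ whose palette has at most two colors, excluding every coloring of $K_4$ in which two vertices carry a color $i$ and the other two carry a color $j\ne i$. - $\mathcal{O}^2$: all colorful graphs of the following forms: $C_4$ where each vertex carries exactly one color and the colors on one pair of non-adjacent vertices are disjoint from those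 on the other pair; $K_3$ where each vertex carries exactly two colors; $K_{1,3}$ where each leaf carries exactly two colors and the center none. - $\tilde{\mathcal{O}}^2$: the members of $\mathcal{O}^2$ whose palette has at most two colors. - $\mathcal{O}^3$: all $K_1$ whose vertex carries exactly three colors. - $\mathcal{O}^4$: all $2\cdot K_1$ (two isolated vertices) where each vertex carries exactly two colors and four distinct colors occur in total. $\mathcal{O}_{[q]}$ is the set of members of $\mathcal{O}$ whose palette is a subset of $[q]$, considered up to isomorphism. *)

theory Defs
  imports Complex_Main "Graph_Theory.Graph_Theory"
begin

(* A finite simple graph is a pair_graph of Graph_Theory: a finite, loop-free, symmetric digraph
   without parallel arcs, so an edge uv is the pair of arcs (u,v), (v,u). *)

type_synonym 'v colored = "'v pair_pre_digraph \<times> ('v \<Rightarrow> nat set)"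

(* Only the values of \<chi> on the vertices matter; isomorphism ignores the others. *)
definition colorful_graph :: "'v colored \<Rightarrow> bool" where
  "colorful_graph = (\<lambda>(G, \<chi>). pair_graph G \<and>
     (\<forall>v \<in> pverts G. finite (\<chi> v) \<and> (\<forall>i \<in> \<chi> v. 0 < i)))"

definition palette :: "'v colored \<Rightarrow> nat set" where
  "palette = (\<lambda>(G, \<chi>). \<Union>v \<in> pverts G. \<chi> v)"

definition colorful_iso :: "'v colored \<Rightarrow> 'w colored \<Rightarrow> bool" where
  "colorful_iso = (\<lambda>(G, \<chi>) (H, \<psi>).
     \<exists>h. pre_digraph.digraph_isomorphism (with_proj G) h
       \<and> with_proj H = app_iso h (with_proj G)
       \<and> (\<forall>v \<in> pverts G. \<psi> (iso_verts h v) = \<chi> v))"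

lemma colorful_iso_iff:
  assumes "pair_graph G" "pair_graph H"
  shows "colorful_iso (G, \<chi>) (H, \<psi>) \<longleftrightarrow>
    (\<exists>f. bij_betw f (pverts G) (pverts H) \<and>
      (\<forall>u \<in> pverts G. \<forall>v \<in> pverts G. (u, v) \<in> parcs G \<longleftrightarrow> (f u, f v) \<in> parcs H) \<and>
      (\<forall>v \<in> pverts G. \<psi> (f v) = \<chi> v))" (is "?L \<longleftrightarrow> ?R")
proof
  interpret G: pair_graph G by fact
  interpret H: pair_graph H by fact
  assume ?L
  then obtain h where h: "pre_digraph.digraph_isomorphism (with_proj G) h"
    and H: "with_proj H = app_iso h (with_proj G)"
    and col: "\<forall>v \<in> pverts G. \<psi> (iso_verts h v) = \<chi> v"
    by (auto simp: colorful_iso_def)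
  have pv: "pverts H = iso_verts h ` pverts G" using H by (metis with_proj_simps(1) verts_app_iso)
  have pa: "parcs H = iso_arcs h ` parcs G" using H by (metis with_proj_simps(2) arcs_app_iso)
  have t: "iso_tail h = fst" using H by (metis with_proj_simps(4) tail_app_iso)
  have hd: "iso_head h = snd" using H by (metis with_proj_simps(5) head_app_iso)
  have inj: "inj_on (iso_verts h) (pverts G)"
    and arc: "\<And>a. a \<in> parcs G \<Longrightarrow> iso_arcs h a = (iso_verts h (fst a), iso_verts h (snd a))"
    using h by (auto simp: pre_digraph.digraph_isomorphism_def t hd prod_eq_iff)
  have "bij_betw (iso_verts h) (pverts G) (pverts H)" using inj pv by (simp add: bij_betw_def)
  moreover have "(u, v) \<in> parcs G \<longleftrightarrow> (iso_verts h u, iso_verts h v) \<in> parcs H"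
    if "u \<in> pverts G" "v \<in> pverts G" for u v
  proof
    assume "(u, v) \<in> parcs G"
    then show "(iso_verts h u, iso_verts h v) \<in> parcs H" using arc pa by force
  next
    assume "(iso_verts h u, iso_verts h v) \<in> parcs H"
    then obtain a where a: "a \<in> parcs G" "iso_verts h u = iso_verts h (fst a)" "iso_verts h v = iso_verts h (snd a)"
      using arc pa by auto
    then have "u = fst a" "v = snd a"
      using inj that G.arc_fst_in_verts G.arc_snd_in_verts by (auto dest: inj_onD)
    then show "(u, v) \<in> parcs G" using a by simp
  qed
  ultimately show ?R using col by blast
next
  interpret G: pair_graph G by fact
  interpret H: pair_graph H by fact
  assume ?R
  then obtain f where bij: "bij_betw f (pverts G) (pverts H)"
    and adj: "\<And>u v. u \<in> pverts G \<Longrightarrow> v \<in> pverts G \<Longrightarrow> (u, v) \<in> parcs G \<longleftrightarrow> (f u, f v) \<in> parcs H"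
    and col: "\<forall>v \<in> pverts G. \<psi> (f v) = \<chi> v" by blast
  have inj: "inj_on f (pverts G)" and im: "f ` pverts G = pverts H"
    using bij by (auto simp: bij_betw_def)
  define h where "h = \<lparr>iso_verts = f, iso_arcs = map_prod f f, iso_head = snd, iso_tail = fst\<rparr>"
  have 1: "inj_on (map_prod f f) (parcs G)"
    by (rule inj_on_subset[OF map_prod_inj_on[OF inj inj]]) (auto dest: G.in_arcsD1 G.in_arcsD2)
  have 2: "map_prod f f ` parcs G = parcs H"
  proof (rule set_eqI, rule iffI)
    fix e assume "e \<in> parcs H"
    then obtain a b where e: "e = (a, b)" "(a, b) \<in> parcs H" by (cases e) auto
    then obtain u v where "u \<in> pverts G" "v \<in> pverts G" "a = f u" "b = f v"
      using im H.in_arcsD1 H.in_arcsD2 by (metis imageE)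
    with e adj show "e \<in> map_prod f f ` parcs G" by force
  next
    fix e assume "e \<in> map_prod f f ` parcs G"
    then obtain u v where uv: "e = (f u, f v)" "(u, v) \<in> parcs G" by auto
    then show "e \<in> parcs H" using adj[of u v] G.in_arcsD1[OF uv(2)] G.in_arcsD2[OF uv(2)] by simp
  qed
  have "pre_digraph.digraph_isomorphism (with_proj G) h"
    unfolding pre_digraph.digraph_isomorphism_def
    using inj 1 G.wf_digraph by (auto simp: h_def)
  moreover have "with_proj H = app_iso h (with_proj G)"
    using im 2 by (simp add: h_def app_iso_def with_proj_def)
  ultimately show ?L using col by (auto simp: colorful_iso_def h_def)
qed
definition iso_on :: "'v colored set \<Rightarrow> 'v colored rel" where
  "iso_on A = {(X, Y). X \<in> A \<and> Y \<in> A \<and> colorful_iso X Y}"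

lemma colorful_graph_pair_graph: "colorful_graph (G, \<chi>) \<Longrightarrow> pair_graph G"
  by (simp add: colorful_graph_def)

lemma equiv_iso_on:
  assumes "\<And>X. X \<in> A \<Longrightarrow> colorful_graph X"
  shows "equiv A (iso_on A)"
proof (rule equivI)
  have iff: "colorful_iso (G, \<chi>) (H, \<psi>) \<longleftrightarrow>
    (\<exists>f. bij_betw f (pverts G) (pverts H) \<and>
      (\<forall>u \<in> pverts G. \<forall>v \<in> pverts G. (u, v) \<in> parcs G \<longleftrightarrow> (f u, f v) \<in> parcs H) \<and>
      (\<forall>v \<in> pverts G. \<psi> (f v) = \<chi> v))" if "(G, \<chi>) \<in> A" "(H, \<psi>) \<in> A" for G \<chi> H \<psi>
    using that assms by (intro colorful_iso_iff) (auto intro: colorful_graph_pair_graph)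
  show "iso_on A \<subseteq> A \<times> A" by (auto simp: iso_on_def)
  show "refl_on A (iso_on A)"
    by (rule refl_onI) (auto simp: iso_on_def iff intro!: exI[of _ id])
  show "sym (iso_on A)"
  proof (rule symI)
    fix X Y assume "(X, Y) \<in> iso_on A"
    moreover obtain G \<chi> H \<psi> where [simp]: "X = (G, \<chi>)" "Y = (H, \<psi>)" by (cases X, cases Y)
    ultimately have A: "(G, \<chi>) \<in> A" "(H, \<psi>) \<in> A" and "colorful_iso (G, \<chi>) (H, \<psi>)"
      by (auto simp: iso_on_def)
    then obtain f where b: "bij_betw f (pverts G) (pverts H)"
      and a: "\<forall>u \<in> pverts G. \<forall>v \<in> pverts G. (u, v) \<in> parcs G \<longleftrightarrow> (f u, f v) \<in> parcs H"
      and c: "\<forall>v \<in> pverts G. \<psi> (f v) = \<chi> v" by (auto simp: iff)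
    let ?g = "inv_into (pverts G) f"
    have g: "?g w \<in> pverts G" "f (?g w) = w" if "w \<in> pverts H" for w
      using b that by (auto simp: bij_betw_def inv_into_into f_inv_into_f)
    have "bij_betw ?g (pverts H) (pverts G)" using b by (rule bij_betw_inv_into)
    moreover have "(u, v) \<in> parcs H \<longleftrightarrow> (?g u, ?g v) \<in> parcs G" if "u \<in> pverts H" "v \<in> pverts H" for u v
      using a[rule_format, OF g(1)[OF that(1)] g(1)[OF that(2)]] by (simp add: g(2) that)
    moreover have "\<chi> (?g w) = \<psi> w" if "w \<in> pverts H" for w
      using c[rule_format, OF g(1)[OF that]] by (simp add: g(2) that)
    ultimately have "colorful_iso (H, \<psi>) (G, \<chi>)" unfolding iff[OF A(2) A(1)] by blast
    then show "(Y, X) \<in> iso_on A" using A by (simp add: iso_on_def)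
  qed
  show "trans (iso_on A)"
  proof (rule transI)
    fix X Y Z assume 1: "(X, Y) \<in> iso_on A" "(Y, Z) \<in> iso_on A"
    obtain G \<chi> H \<psi> K \<xi> where [simp]: "X = (G, \<chi>)" "Y = (H, \<psi>)" "Z = (K, \<xi>)" by (cases X, cases Y, cases Z)
    from 1 have A: "(G, \<chi>) \<in> A" "(H, \<psi>) \<in> A" "(K, \<xi>) \<in> A" by (auto simp: iso_on_def)
    from 1 obtain f where f: "bij_betw f (pverts G) (pverts H)"
      "\<forall>u \<in> pverts G. \<forall>v \<in> pverts G. (u, v) \<in> parcs G \<longleftrightarrow> (f u, f v) \<in> parcs H"
      "\<forall>v \<in> pverts G. \<psi> (f v) = \<chi> v" by (auto simp: iff iso_on_def)
    from 1 obtain g where g: "bij_betw g (pverts H) (pverts K)"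
      "\<forall>u \<in> pverts H. \<forall>v \<in> pverts H. (u, v) \<in> parcs H \<longleftrightarrow> (g u, g v) \<in> parcs K"
      "\<forall>v \<in> pverts H. \<xi> (g v) = \<psi> v" by (auto simp: iff iso_on_def)
    have m: "f v \<in> pverts H" if "v \<in> pverts G" for v using f(1) that by (auto simp: bij_betw_def)
    have "colorful_iso (G, \<chi>) (K, \<xi>)" unfolding iff[OF A(1) A(3)]
      using bij_betw_trans[OF f(1) g(1)] f g m by (intro exI[of _ "g \<circ> f"]) simp
    then show "(X, Z) \<in> iso_on A" using A by (simp add: iso_on_def)
  qed
qed

abbreviation deg :: "'v pair_pre_digraph \<Rightarrow> 'v \<Rightarrow> nat" where
  "deg G v \<equiv> out_degree (with_proj G) v"

definition minus_edge :: "('v pair_pre_digraph \<Rightarrow> bool) \<Rightarrow> 'v pair_pre_digraph \<Rightarrow> bool" where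
  "minus_edge P G \<longleftrightarrow> (\<exists>H u v. P H \<and> (u, v) \<in> parcs H \<and>
     G = \<lparr>pverts = pverts H, parcs = parcs H - {(u, v), (v, u)}\<rparr>)"

definition is_cycle4 :: "'v \<Rightarrow> 'v \<Rightarrow> 'v \<Rightarrow> 'v \<Rightarrow> 'v pair_pre_digraph \<Rightarrow> bool" where
  "is_cycle4 a b c d G \<longleftrightarrow> distinct [a, b, c, d] \<and> pverts G = {a, b, c, d} \<and>
     parcs G = {(a, b), (b, c), (c, d), (d, a)} \<union> {(a, b), (b, c), (c, d), (d, a)}\<inverse>"

(* Vertices of degree k carry exactly m colors each, and all other vertices carry none. *)
definition colors_at_degree :: "nat \<Rightarrow> nat \<Rightarrow> 'v colored \<Rightarrow> bool" where
  "colors_at_degree k m = (\<lambda>(G, \<chi>).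
     \<forall>v \<in> pverts G. if deg G v = k then card (\<chi> v) = m else \<chi> v = {})"

definition colors_everywhere :: "nat \<Rightarrow> 'v colored \<Rightarrow> bool" where
  "colors_everywhere m = (\<lambda>(G, \<chi>). \<forall>v \<in> pverts G. card (\<chi> v) = m)"

definition Obs0 :: "'v colored set" where
  "Obs0 = {(G, \<chi>). colorful_graph (G, \<chi>) \<and>
     (K\<^bsub>5\<^esub> (with_proj G) \<or> K\<^bsub>3,3\<^esub> (with_proj G)) \<and> (\<forall>v \<in> pverts G. \<chi> v = {})}"

definition Obs1 :: "'v colored set" where
  "Obs1 = {(G, \<chi>). colorful_graph (G, \<chi>) \<and>
     (minus_edge (\<lambda>H. K\<^bsub>5\<^esub> (with_proj H)) G \<and> colors_at_degree 3 1 (G, \<chi>)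
    \<or> K\<^bsub>4\<^esub> (with_proj G) \<and> colors_everywhere 1 (G, \<chi>)
    \<or> minus_edge (\<lambda>H. K\<^bsub>3,3\<^esub> (with_proj H)) G \<and> colors_at_degree 2 1 (G, \<chi>)
    \<or> K\<^bsub>2,3\<^esub> (with_proj G) \<and> colors_at_degree 2 1 (G, \<chi>))}"

definition two_two_K4 :: "'v colored \<Rightarrow> bool" where
  "two_two_K4 = (\<lambda>(G, \<chi>). K\<^bsub>4\<^esub> (with_proj G) \<and>
     (\<exists>a b c d i j. distinct [a, b, c, d] \<and> pverts G = {a, b, c, d} \<and> i \<noteq> j \<and>
        \<chi> a = {i} \<and> \<chi> b = {i} \<and> \<chi> c = {j} \<and> \<chi> d = {j}))"

definition Obs1_tilde :: "'v colored set" where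
  "Obs1_tilde = {X \<in> Obs1. card (palette X) \<le> 2 \<and> \<not> two_two_K4 X}"

definition Obs2 :: "'v colored set" where
  "Obs2 = {(G, \<chi>). colorful_graph (G, \<chi>) \<and>
     ((\<exists>a b c d. is_cycle4 a b c d G \<and> colors_everywhere 1 (G, \<chi>) \<and>
         (\<chi> a \<union> \<chi> c) \<inter> (\<chi> b \<union> \<chi> d) = {})
    \<or> K\<^bsub>3\<^esub> (with_proj G) \<and> colors_everywhere 2 (G, \<chi>)
    \<or> K\<^bsub>1,3\<^esub> (with_proj G) \<and> colors_at_degree 1 2 (G, \<chi>))}"

definition Obs2_tilde :: "'v colored set" where
  "Obs2_tilde = {X \<in> Obs2. card (palette X) \<le> 2}"

definition Obs3 :: "'v colored set" where
  "Obs3 = {(G, \<chi>). colorful_graph (G, \<chi>) \<and> K\<^bsub>1\<^esub> (with_proj G) \<and> colors_everywhere 3 (G, \<chi>)}"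

definition Obs4 :: "'v colored set" where
  "Obs4 = {(G, \<chi>). colorful_graph (G, \<chi>) \<and> card (pverts G) = 2 \<and> parcs G = {} \<and>
     colors_everywhere 2 (G, \<chi>) \<and> card (palette (G, \<chi>)) = 4}"

definition Obs :: "'v colored set" where
  "Obs = Obs0 \<union> Obs1_tilde \<union> Obs2_tilde \<union> Obs3 \<union> Obs4"

definition Obs_upto :: "nat \<Rightarrow> 'v colored set" where
  "Obs_upto q = {X \<in> Obs. palette X \<subseteq> {1..q}}"

(* Every finite graph has an isomorphic copy with vertices in nat, so nat represents every
   isomorphism class exactly once. *)
definition Obs_classes :: "nat \<Rightarrow> nat colored set set" where
  "Obs_classes q = Obs_upto q // iso_on (Obs_upto q)"

end

(* The eleven graphs underlying the obstructions are told apart by their numbers of vertices and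
   edges. Within one of the graphs, an obstruction is determined up to isomorphism by the multiset of
   its vertex palettes: its colorings follow so few patterns that the automorphisms of the graph
   realise every admissible arrangement of a given multiset. Picking one arrangement per multiset
   (the normal colorings below) and counting gives
     2 + q(q+1) + 2 q^2 + 3 binom(q,2) + binom(q,3) + 3 binom(q,4),
   from the two uncolored graphs; K5 and K33 minus an edge; K4 and K23; C4, K3 and K13; K1;
   and 2 K1. *)
theory Submission
  imports Defs
begin

subsection \<open>Explicit copies of the eleven underlying graphs\<close>

text \<open>Isomorphism between graphs on an arbitrary vertex type is awkward to handle directly.
  Every obstruction is therefore presented by a list of distinct vertices: positions determine
  adjacency, and the palettes read along the list form a list of sets. Looking up positions is then
  an isomorphism onto a copy whose vertices are initial natural numbers. Automorphisms enter only as
  relistings, that is, as two orders of the vertices that yield the same graph. They serve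
  existence: some order makes the palette list normal. Uniqueness involves no automorphisms, because
  the multiset of palettes is an isomorphism invariant and distinct normal colorings of one graph
  have distinct multisets. The colorings follow few patterns because of the bound of two colors on
  the palette, together with the exclusion of the two-two colorings of \<open>K4\<close>.\<close>

text \<open>In the minus-edge graphs 0 and 1 are the ends of the deleted edge; in every shape with
  uncolored vertices the colored ones come first.\<close>

datatype shape = K5 | K33 | K5_minus | K4 | K33_minus | K23 | C4 | K3 | K13 | K1 | TwoK1

text \<open>Each edge is listed in one direction only. The sides of \<open>K33\<close> are 0, 2, 3
  and 1, 4, 5, so that 0 and 1 are adjacent and \<open>K33_minus\<close> arises by dropping the
  first pair of the list, just as \<open>K5_minus\<close> arises from \<open>K5\<close>.\<close>

fun edges :: "shape \<Rightarrow> (nat \<times> nat) list" where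
  "edges K5 = [(0,1), (0,2), (0,3), (0,4), (1,2), (1,3), (1,4), (2,3), (2,4), (3,4)]"
| "edges K5_minus = [(0,2), (0,3), (0,4), (1,2), (1,3), (1,4), (2,3), (2,4), (3,4)]"
| "edges K33 = [(0,1), (0,4), (0,5), (2,1), (2,4), (2,5), (3,1), (3,4), (3,5)]"
| "edges K33_minus = [(0,4), (0,5), (2,1), (2,4), (2,5), (3,1), (3,4), (3,5)]"
| "edges K4 = [(0,1), (0,2), (0,3), (1,2), (1,3), (2,3)]"
| "edges K23 = [(0,3), (0,4), (1,3), (1,4), (2,3), (2,4)]"
| "edges C4 = [(0,1), (1,2), (2,3), (3,0)]"
| "edges K3 = [(0,1), (0,2), (1,2)]"
| "edges K13 = [(0,3), (1,3), (2,3)]"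
| "edges K1 = []"
| "edges TwoK1 = []"

fun num_verts :: "shape \<Rightarrow> nat" where
  "num_verts K5 = 5"
| "num_verts K5_minus = 5"
| "num_verts K33 = 6"
| "num_verts K33_minus = 6"
| "num_verts K4 = 4"
| "num_verts K23 = 5"
| "num_verts C4 = 4"
| "num_verts K3 = 3"
| "num_verts K13 = 4"
| "num_verts K1 = 1"
| "num_verts TwoK1 = 2"

definition graph_of :: "shape \<Rightarrow> 'v list \<Rightarrow> 'v pair_pre_digraph" where
  "graph_of s xs = \<lparr>pverts = set xs,
     parcs = (\<lambda>(i, j). (xs ! i, xs ! j)) ` set (edges s) \<union> (\<lambda>(i, j). (xs ! j, xs ! i)) ` set (edges s)\<rparr>"

lemma edges_less: "(i, j) \<in> set (edges s) \<Longrightarrow> i < num_verts s \<and> j < num_verts s \<and> i \<noteq> j"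
  by (cases s) auto

lemma pair_graph_graph_of:
  assumes "distinct xs" "length xs = num_verts s"
  shows "pair_graph (graph_of s xs)"
proof
  fix e assume e: "e \<in> parcs (graph_of s xs)"
  then obtain i j where ij: "e = (xs ! i, xs ! j)" "i < num_verts s" "j < num_verts s"
    "i \<noteq> j"
    using edges_less by (fastforce simp: graph_of_def)
  show "fst e \<in> pverts (graph_of s xs)" "snd e \<in> pverts (graph_of s xs)"
    using ij assms by (auto simp: graph_of_def)
  show "fst e \<noteq> snd e" using ij assms by (simp add: nth_eq_iff_index_eq)
next
  show "finite (pverts (graph_of s xs))" "finite (parcs (graph_of s xs))"
    by (auto simp: graph_of_def)
  show "symmetric (with_proj (graph_of s xs))"
    by (fastforce simp: graph_of_def symmetric_def intro!: symI)
qed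

section \<open>Recognizing the graphs and their degrees from a listing of the vertices\<close>

lemma deg_eq_card_neighbours: "deg G v = card {w. (v, w) \<in> parcs G}"
proof -
  have "out_arcs (with_proj G) v = Pair v ` {w. (v, w) \<in> parcs G}"
    by (auto simp: out_arcs_def)
  then show ?thesis by (simp add: out_degree_def card_image inj_on_def)
qed

text \<open>For these four shapes \<open>edges\<close> meets every pair of distinct positions, so
  its symmetric closure is invariant under permutations. Hence any listing of the vertices presents
  the graph, which later allows vertices to be reordered freely.\<close>

lemma complete_iff:
  assumes "set xs = pverts G" "distinct xs" "length xs = num_verts s" "s \<in> {K1, K3, K4, K5}"
  shows "complete_digraph (num_verts s) (with_proj G) \<longleftrightarrow> G = graph_of s xs"
proof -
  have "(i, j) \<in> set (edges s) \<or> (j, i) \<in> set (edges s)" if "i < num_verts s"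
    "j < num_verts s" "i \<noteq> j" for i j
  proof -
    have "\<forall>i < num_verts s. \<forall>j < num_verts s. i \<noteq> j \<longrightarrow> (i, j) \<in> set (edges s) \<or> (j, i) \<in> set (edges s)"
      using assms(4) by (elim insertE emptyE) (simp_all add: numeral_eq_Suc All_less_Suc)
    then show ?thesis using that by blast
  qed
  then have "set (edges s) \<union> (\<lambda>(i, j). (j, i)) ` set (edges s) =
      {(i, j). i < num_verts s \<and> j < num_verts s \<and> i \<noteq> j}" (is "?E = ?I")
    using edges_less by (fastforce simp: image_iff)
  moreover have "parcs (graph_of s xs) = (\<lambda>(i, j). (xs ! i, xs ! j)) ` ?E"
    by (simp add: graph_of_def image_Un image_image split_def)
  moreover have "(\<lambda>(i, j). (xs ! i, xs ! j)) ` ?I =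
      {(u, v). u \<in> set xs \<and> v \<in> set xs \<and> u \<noteq> v}"
  proof (intro equalityI subsetI)
    fix e assume "e \<in> {(u, v). u \<in> set xs \<and> v \<in> set xs \<and> u \<noteq> v}"
    then obtain i j where "e = (xs ! i, xs ! j)" "i < length xs" "j < length xs" "i \<noteq> j"
      by (auto simp: in_set_conv_nth)
    then have "e = (\<lambda>(i, j). (xs ! i, xs ! j)) (i, j)" "(i, j) \<in> ?I" using assms(3)
      by auto
    then show "e \<in> (\<lambda>(i, j). (xs ! i, xs ! j)) ` ?I" by (rule image_eqI)
  qed (use assms(2,3) in \<open>auto simp: nth_eq_iff_index_eq\<close>)
  ultimately have "parcs (graph_of s xs) = {(u, v). (u, v) \<in> pverts G \<times> pverts G \<and> u \<noteq> v}"
    using assms(1) by simp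
  moreover have "card (pverts G) = num_verts s" "finite (pverts G)"
    "pverts (graph_of s xs) = pverts G"
    using assms(1,3) distinct_card[OF assms(2)] by (auto simp: graph_of_def simp flip: assms(1))
  ultimately show ?thesis
    by (cases G, cases "graph_of s xs") (auto simp: complete_digraph_pair_def)
qed

lemma card_3_distinct:
  "card S = 3 \<Longrightarrow> \<exists>a b c. S = {a,b,c} \<and> distinct [a,b,c]"
  by (auto simp: card_3_iff)

text \<open>Positive cardinalities supply finiteness of both sides, since \<open>card\<close> is 0
  on infinite sets.\<close>

lemma complete_bipartiteI:
  assumes "pverts G = U \<union> V" "U \<inter> V = {}" "card U = m" "card V = n" "0 < m" "0 < n"
    "parcs G = U \<times> V \<union> V \<times> U"
  shows "complete_bipartite_digraph m n (with_proj G)"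
  unfolding complete_bipartite_digraph_pair_def
  using assms by (metis card_gt_0_iff finite_UnI)

lemma K33_iff:
  "complete_bipartite_digraph 3 3 (with_proj G) \<longleftrightarrow>
    (\<exists>a b c d e f. distinct [a,b,c,d,e,f] \<and> G = graph_of K33 [a,b,c,d,e,f])" (is "?L \<longleftrightarrow> ?R")
proof
  assume ?L
  then obtain U V where UV: "pverts G = U \<union> V" "U \<inter> V = {}" "card U = 3" "card V = 3"
    "parcs G = U \<times> V \<union> V \<times> U"
      by (auto simp: complete_bipartite_digraph_pair_def)
  obtain a c d where U: "U = {a,c,d}" "distinct [a,c,d]" using card_3_distinct[OF UV(3)] by auto
  obtain b e f where V: "V = {b,e,f}" "distinct [b,e,f]" using card_3_distinct[OF UV(4)] by auto
  have "distinct [a,b,c,d,e,f]" using UV(2) U V by auto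
  moreover from this have "G = graph_of K33 [a,b,c,d,e,f]" using UV(1,5) U V
    by (cases G) (auto simp: graph_of_def)
  ultimately show ?R by blast
next
  assume ?R
  then obtain a c d b e f where "distinct [a,b,c,d,e,f]" "G = graph_of K33 [a,b,c,d,e,f]" by blast
  then show ?L
    by (intro complete_bipartiteI[of _ "{a,c,d}" "{b,e,f}"]) (auto simp: graph_of_def)
qed

lemma K23_iff:
  "complete_bipartite_digraph 2 3 (with_proj G) \<longleftrightarrow>
    (\<exists>a b c d e. distinct [a,b,c,d,e] \<and> G = graph_of K23 [a,b,c,d,e])" (is "?L \<longleftrightarrow> ?R")
proof
  assume ?L
  then obtain U V where UV: "pverts G = U \<union> V" "U \<inter> V = {}" "card U = 2" "card V = 3"
    "parcs G = U \<times> V \<union> V \<times> U"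
      by (auto simp: complete_bipartite_digraph_pair_def)
  obtain d e where U: "U = {d,e}" "distinct [d,e]" using UV(3)[unfolded card_2_iff] by auto
  obtain a b c where V: "V = {a,b,c}" "distinct [a,b,c]" using card_3_distinct[OF UV(4)] by auto
  have "distinct [a,b,c,d,e]" using UV(2) U V by auto
  moreover from this have "G = graph_of K23 [a,b,c,d,e]" using UV(1,5) U V
    by (cases G) (auto simp: graph_of_def)
  ultimately show ?R by blast
next
  assume ?R
  then obtain a b c d e where "distinct [a,b,c,d,e]" "G = graph_of K23 [a,b,c,d,e]" by blast
  then show ?L
    by (intro complete_bipartiteI[of _ "{d,e}" "{a,b,c}"]) (auto simp: graph_of_def)
qed

lemma K13_iff:
  "complete_bipartite_digraph 1 3 (with_proj G) \<longleftrightarrow>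
    (\<exists>a b c d. distinct [a,b,c,d] \<and> G = graph_of K13 [a,b,c,d])" (is "?L \<longleftrightarrow> ?R")
proof
  assume ?L
  then obtain U V where UV: "pverts G = U \<union> V" "U \<inter> V = {}" "card U = 1" "card V = 3"
    "parcs G = U \<times> V \<union> V \<times> U"
      by (auto simp: complete_bipartite_digraph_pair_def)
  obtain d where U: "U = {d}" using UV(3) by (rule card_1_singletonE)
  obtain a b c where V: "V = {a,b,c}" "distinct [a,b,c]" using card_3_distinct[OF UV(4)] by auto
  have "distinct [a,b,c,d]" using UV(2) U V by auto
  moreover from this have "G = graph_of K13 [a,b,c,d]" using UV(1,5) U V
    by (cases G) (auto simp: graph_of_def)
  ultimately show ?R by blast
next
  assume ?R
  then obtain a b c d where "distinct [a,b,c,d]" "G = graph_of K13 [a,b,c,d]" by blast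
  then show ?L
    by (intro complete_bipartiteI[of _ "{d}" "{a,b,c}"]) (auto simp: graph_of_def)
qed

text \<open>\<open>colors_at_degree\<close> singles out the colored vertices by their degree; these
  values identify them with the first two positions.\<close>

lemma degrees_K5_minus:
  assumes "distinct [a,b,c,d,e]"
  shows "\<forall>v \<in> {a,b}. deg (graph_of K5_minus [a,b,c,d,e]) v = 3"
    "\<forall>v \<in> {c,d,e}. deg (graph_of K5_minus [a,b,c,d,e]) v = 4"
  using assms by (auto simp: deg_eq_card_neighbours graph_of_def Collect_disj_eq)

lemma K5_minus_edge:
  assumes "distinct [a,b,c,d,e]"
  shows "graph_of K5_minus [a,b,c,d,e] =
    \<lparr>pverts = pverts (graph_of K5 [a,b,c,d,e]), parcs = parcs (graph_of K5 [a,b,c,d,e]) - {(a, b), (b, a)}\<rparr>"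
  using assms by (auto simp: graph_of_def)

lemma K33_minus_edge:
  assumes "distinct [a,b,c,d,e,f]"
  shows "graph_of K33_minus [a,b,c,d,e,f] =
    \<lparr>pverts = pverts (graph_of K33 [a,b,c,d,e,f]), parcs = parcs (graph_of K33 [a,b,c,d,e,f]) - {(a, b), (b, a)}\<rparr>"
  using assms by (auto simp: graph_of_def)

text \<open>Listing the ends of the deleted edge first puts that edge at positions 0 and 1. As a
  complete graph accepts every listing, the other three vertices may follow in any order.\<close>

lemma K5_minus_iff:
  "minus_edge (\<lambda>H. complete_digraph 5 (with_proj H)) G \<longleftrightarrow>
    (\<exists>a b c d e. distinct [a,b,c,d,e] \<and> G = graph_of K5_minus [a,b,c,d,e])" (is "?L \<longleftrightarrow> ?R")
proof
  assume ?L
  then obtain H u v where H: "complete_digraph 5 (with_proj H)" and uv: "(u, v) \<in> parcs H"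
    and G: "G = \<lparr>pverts = pverts H, parcs = parcs H - {(u, v), (v, u)}\<rparr>"
    by (auto simp: minus_edge_def)
  have *: "u \<in> pverts H" "v \<in> pverts H" "u \<noteq> v" "card (pverts H) = 5"
    "finite (pverts H)"
    using H uv by (auto simp: complete_digraph_pair_def)
  then have "card (pverts H - {u, v}) = 3" by (simp add: card_Diff_subset)
  from card_3_distinct[OF this] obtain c d e
    where S: "pverts H - {u, v} = {c, d, e}" "distinct [c, d, e]" by blast
  then have P: "pverts H = {u, v, c, d, e}" using * by blast
  have D: "distinct [u, v, c, d, e]" using S * by auto
  have "H = graph_of K5 [u, v, c, d, e]"
    using complete_iff[of "[u, v, c, d, e]" H K5] H P D by simp
  then have "G = graph_of K5_minus [u, v, c, d, e]" using G K5_minus_edge[OF D] by simp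
  then show ?R using D by blast
next
  assume ?R
  then obtain a b c d e where D: "distinct [a, b, c, d, e]"
    and G: "G = graph_of K5_minus [a, b, c, d, e]"
    by blast
  have "complete_digraph 5 (with_proj (graph_of K5 [a, b, c, d, e]))"
    using complete_iff[of "[a, b, c, d, e]" "graph_of K5 [a, b, c, d, e]" K5] D
    by (simp add: graph_of_def)
  moreover have "(a, b) \<in> parcs (graph_of K5 [a, b, c, d, e])" by (simp add: graph_of_def)
  ultimately show ?L unfolding minus_edge_def G K5_minus_edge[OF D] by blast
qed

text \<open>\<open>K33_iff\<close> gives a listing without control over its first two entries,
  whereas deleting an edge requires that edge at the front. An arc may leave either side, so the
  sides are first named such that u lies in U.\<close>

lemma K33_edge:
  assumes "complete_bipartite_digraph 3 3 (with_proj H)" "(u, v) \<in> parcs H"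
  shows "\<exists>c d e f. distinct [u,v,c,d,e,f] \<and> H = graph_of K33 [u,v,c,d,e,f]"
proof -
  obtain U V where UV: "pverts H = U \<union> V" "U \<inter> V = {}" "card U = 3" "card V = 3"
    "parcs H = U \<times> V \<union> V \<times> U" "u \<in> U" "v \<in> V"
  proof -
    obtain U V where UV: "pverts H = U \<union> V" "U \<inter> V = {}" "card U = 3" "card V = 3"
      "parcs H = U \<times> V \<union> V \<times> U"
      using assms(1) by (auto simp: complete_bipartite_digraph_pair_def)
    then consider "u \<in> U" "v \<in> V" | "u \<in> V" "v \<in> U" using assms(2) by auto
    then show ?thesis
    proof cases
      case 1 then show ?thesis using that UV by blast
    next
      case 2 then show ?thesis using that[of V U] UV by (auto simp: Un_commute Int_commute)
    qed
  qed
  have "card (U - {u}) = 2" "card (V - {v}) = 2" using UV by simp_all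
  then obtain c d e f where U: "U - {u} = {c, d}" "c \<noteq> d" and V: "V - {v} = {e, f}"
    "e \<noteq> f"
    by (auto simp: card_2_iff)
  then have U': "U = {u, c, d}" and V': "V = {v, e, f}" using UV by blast+
  have D: "distinct [u,v,c,d,e,f]" using U V UV(2,6,7) unfolding U' V' by auto
  moreover have "H = graph_of K33 [u,v,c,d,e,f]"
    using UV(1,5) unfolding U' V' by (cases H) (auto simp: graph_of_def)
  ultimately show ?thesis by blast
qed

lemma K33_minus_iff:
  "minus_edge (\<lambda>H. complete_bipartite_digraph 3 3 (with_proj H)) G \<longleftrightarrow>
    (\<exists>a b c d e f. distinct [a,b,c,d,e,f] \<and> G = graph_of K33_minus [a,b,c,d,e,f])" (is "?L \<longleftrightarrow> ?R")
proof
  assume ?L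
  then obtain H u v where H: "complete_bipartite_digraph 3 3 (with_proj H)"
    and uv: "(u, v) \<in> parcs H"
    and G: "G = \<lparr>pverts = pverts H, parcs = parcs H - {(u, v), (v, u)}\<rparr>"
    by (auto simp: minus_edge_def)
  obtain c d e f where D: "distinct [u,v,c,d,e,f]" and "H = graph_of K33 [u,v,c,d,e,f]"
    using K33_edge[OF H uv] by blast
  then have "G = graph_of K33_minus [u,v,c,d,e,f]" using G K33_minus_edge[OF D] by simp
  then show ?R using D by blast
next
  assume ?R
  then obtain a b c d e f where D: "distinct [a,b,c,d,e,f]"
    and G: "G = graph_of K33_minus [a,b,c,d,e,f]"
    by blast
  then have "complete_bipartite_digraph 3 3 (with_proj (graph_of K33 [a,b,c,d,e,f]))"
    unfolding K33_iff by blast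
  moreover have "(a, b) \<in> parcs (graph_of K33 [a,b,c,d,e,f])" by (simp add: graph_of_def)
  ultimately show ?L unfolding minus_edge_def G K33_minus_edge[OF D] by blast
qed

lemma degrees_K33_minus:
  assumes "distinct [a,b,c,d,e,f]"
  shows "\<forall>v \<in> {a,b}. deg (graph_of K33_minus [a,b,c,d,e,f]) v = 2"
    "\<forall>v \<in> {c,d,e,f}. deg (graph_of K33_minus [a,b,c,d,e,f]) v = 3"
  using assms by (auto simp: deg_eq_card_neighbours graph_of_def Collect_disj_eq)

lemma degrees_K23:
  assumes "distinct [a,b,c,d,e]"
  shows "\<forall>v \<in> {a,b,c}. deg (graph_of K23 [a,b,c,d,e]) v = 2"
    "\<forall>v \<in> {d,e}. deg (graph_of K23 [a,b,c,d,e]) v = 3"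
  using assms by (auto simp: deg_eq_card_neighbours graph_of_def Collect_disj_eq)

lemma degrees_K13:
  assumes "distinct [a,b,c,d]"
  shows "\<forall>v \<in> {a,b,c}. deg (graph_of K13 [a,b,c,d]) v = 1"
    "deg (graph_of K13 [a,b,c,d]) d = 3"
  using assms by (auto simp: deg_eq_card_neighbours graph_of_def Collect_disj_eq)

lemma palette_graph_of: "palette (graph_of s xs, \<chi>) = \<Union> (\<chi> ` set xs)"
  by (simp add: palette_def graph_of_def)

lemma pverts_graph_of [simp]: "pverts (graph_of s xs) = set xs"
  by (simp add: graph_of_def)

subsection \<open>Normal forms of the colorings\<close>

text \<open>The condition on the minima selects one of the two orders of an unordered pair.\<close>

definition disjoint_pairs :: "nat \<Rightarrow> (nat set \<times> nat set) set" where
  "disjoint_pairs q = {(S, T). S \<subseteq> {1..q} \<and> T \<subseteq> {1..q} \<and> card S = 2 \<and> card T = 2 \<and>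
     S \<inter> T = {} \<and> Min S < Min T}"

text \<open>Two available colors force these patterns. On \<open>K4\<close> the vertices split as 4
  or 3+1, the split 2+2 being excluded, and on \<open>K23\<close> the colored vertices split as 3 or
  2+1; so the ordered pair (i, j) records the majority color and the color of the remaining vertex,
  with i = j for a single color. On \<open>C4\<close> opposite vertices agree and neighbours differ,
  hence the strict inequality. On \<open>K3\<close> and \<open>K13\<close> two-color palettes inside
  a two-color union all coincide. In each \<open>SIGMA\<close> the larger color comes first because
  it bounds the range of the smaller.\<close>

fun normal_colorings :: "nat \<Rightarrow> shape \<Rightarrow> nat set list set" where
  "normal_colorings q K5 = {[{}, {}, {}, {}, {}]}"
| "normal_colorings q K33 = {[{}, {}, {}, {}, {}, {}]}"
| "normal_colorings q K5_minus = (\<lambda>(j, i). [{i}, {j}, {}, {}, {}]) ` (SIGMA j:{1..q}. {1..j})"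
| "normal_colorings q K4 = (\<lambda>(i, j). [{i}, {i}, {i}, {j}]) ` ({1..q} \<times> {1..q})"
| "normal_colorings q K33_minus = (\<lambda>(j, i). [{i}, {j}, {}, {}, {}, {}]) ` (SIGMA j:{1..q}. {1..j})"
| "normal_colorings q K23 = (\<lambda>(i, j). [{i}, {i}, {j}, {}, {}]) ` ({1..q} \<times> {1..q})"
| "normal_colorings q C4 = (\<lambda>(j, i). [{i}, {j}, {i}, {j}]) ` (SIGMA j:{1..q}. {1..<j})"
| "normal_colorings q K3 = (\<lambda>S. [S, S, S]) ` {S. S \<subseteq> {1..q} \<and> card S = 2}"
| "normal_colorings q K13 = (\<lambda>S. [S, S, S, {}]) ` {S. S \<subseteq> {1..q} \<and> card S = 2}"
| "normal_colorings q K1 = (\<lambda>S. [S]) ` {S. S \<subseteq> {1..q} \<and> card S = 3}"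
| "normal_colorings q TwoK1 = (\<lambda>(S, T). [S, T]) ` disjoint_pairs q"

definition copies :: "nat \<Rightarrow> shape \<Rightarrow> 'v colored set" where
  "copies q s = {(graph_of s xs, \<chi>) | xs \<chi>.
     distinct xs \<and> length xs = num_verts s \<and> map \<chi> xs \<in> normal_colorings q s}"

lemma copiesI:
  assumes "distinct xs" "length xs = num_verts s" "G = graph_of s xs"
    "map \<chi> xs \<in> normal_colorings q s"
  shows "(G, \<chi>) \<in> copies q s"
  using assms by (auto simp: copies_def)

lemma copiesE:
  assumes "(G, \<chi>) \<in> copies q s"
  obtains xs where "distinct xs" "length xs = num_verts s" "G = graph_of s xs"
    "map \<chi> xs \<in> normal_colorings q s"
  using assms by (auto simp: copies_def)

lemma copies_palette:
  assumes "(G, \<chi>) \<in> copies q s"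
  shows "palette (G, \<chi>) \<subseteq> {1..q}"
proof -
  obtain xs where xs: "G = graph_of s xs" "map \<chi> xs \<in> normal_colorings q s"
    using assms by (rule copiesE)
  have "\<Union> (set cs) \<subseteq> {1..q}" if "cs \<in> normal_colorings q s" for cs
    using that by (cases s) (auto 0 3 simp: disjoint_pairs_def dest: subsetD)
  from this[OF xs(2)] show ?thesis by (auto simp: xs(1) palette_graph_of)
qed

lemma copies_palette_card:
  assumes "(G, \<chi>) \<in> copies q s" "s \<noteq> K1" "s \<noteq> TwoK1"
  shows "card (palette (G, \<chi>)) \<le> 2"
proof -
  obtain xs where xs: "G = graph_of s xs" "map \<chi> xs \<in> normal_colorings q s"
    using assms(1) by (rule copiesE)
  have "card (\<Union> (set cs)) \<le> 2" if "cs \<in> normal_colorings q s" for cs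
    using that assms(2,3) by (cases s) (auto simp: card_insert_if)
  from this[OF xs(2)] show ?thesis by (simp add: xs(1) palette_graph_of)
qed

lemma copies_pair_graph: "(G, \<chi>) \<in> copies q s \<Longrightarrow> pair_graph G"
  by (erule copiesE) (simp add: pair_graph_graph_of)

lemma card_verts_copies:
  "(G, \<chi>) \<in> copies q s \<Longrightarrow> card (pverts G) = num_verts s"
  by (erule copiesE) (simp add: distinct_card)

lemma card_1_subset: "card S = 1 \<Longrightarrow> S \<subseteq> {1..q} \<Longrightarrow> \<exists>i \<in> {1..q}. S = {i}"
  by (metis card_1_singletonE insert_subset)

lemma palette_subset:
  "palette (G, \<chi>) \<subseteq> {1..q} \<longleftrightarrow> (\<forall>v \<in> pverts G. \<chi> v \<subseteq> {1..q})"
  by (auto simp: palette_def)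

text \<open>Pigeonhole, in the form that turns the bound on the palette into coincidences among
  singleton palettes.\<close>

lemma card_le_2_eq:
  assumes "card S \<le> 2" "finite S" "x \<in> S" "y \<in> S" "z \<in> S"
  shows "x = y \<or> x = z \<or> y = z"
proof (rule ccontr)
  assume "\<not> ?thesis"
  then have "card {x, y, z} = 3" by simp
  moreover have "card {x, y, z} \<le> card S" using assms by (intro card_mono) auto
  ultimately show False using assms(1) by simp
qed

lemma complete_graph_of:
  assumes "distinct xs" "length xs = num_verts s" "s \<in> {K1, K3, K4, K5}"
  shows "complete_digraph (num_verts s) (with_proj (graph_of s xs))"
  using complete_iff[of xs "graph_of s xs" s] assms by simp

lemma complete_eq_graph_of:
  assumes "complete_digraph (num_verts s) (with_proj G)" "distinct xs" "set xs = pverts G"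
    "s \<in> {K1, K3, K4, K5}"
  shows "length xs = num_verts s" "G = graph_of s xs"
proof -
  have "length xs = card (pverts G)" using distinct_card[OF assms(2)] assms(3) by simp
  also have "\<dots> = num_verts s" using assms(1) unfolding complete_digraph_pair_def by simp
  finally show "length xs = num_verts s" .
  with assms show "G = graph_of s xs" using complete_iff by blast
qed

lemma complete_digraph_enum:
  assumes "complete_digraph n (with_proj G)"
  obtains xs where "set xs = pverts G" "distinct xs" "length xs = n"
proof -
  have "finite (pverts G)" "card (pverts G) = n" using assms
    by (auto simp: complete_digraph_pair_def)
  then show ?thesis using that finite_distinct_list[of "pverts G"] distinct_card by force
qed

section \<open>Each family of obstructions as the copies of one shape\<close>

lemma copies_K5:
  "(G, \<chi>) \<in> copies q K5 \<longleftrightarrow> complete_digraph 5 (with_proj G) \<and> (\<forall>v \<in> pverts G. \<chi> v = {})"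
    (is "?L \<longleftrightarrow> ?R")
proof
  assume ?L
  then obtain xs where xs: "distinct xs" "length xs = num_verts K5" "G = graph_of K5 xs"
    "map \<chi> xs \<in> normal_colorings q K5"
    by (rule copiesE)
  then have "complete_digraph 5 (with_proj G)" using complete_graph_of[of xs K5] by simp
  moreover obtain a b c d e where "xs = [a,b,c,d,e]" using xs(2)
    by (auto simp: numeral_eq_Suc length_Suc_conv)
  ultimately show ?R using xs(3,4) by simp
next
  assume R: ?R
  then obtain xs where xs: "set xs = pverts G" "distinct xs" "length xs = 5"
    using complete_digraph_enum by blast
  then have "G = graph_of K5 xs" using R complete_eq_graph_of[of K5 G xs] by simp
  moreover obtain a b c d e where l: "xs = [a,b,c,d,e]" using xs(3)
    by (auto simp: numeral_eq_Suc length_Suc_conv)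
  ultimately show ?L using R xs by (intro copiesI[of xs]) (simp_all flip: xs(1))
qed

lemma copies_K33:
  "(G, \<chi>) \<in> copies q K33 \<longleftrightarrow> complete_bipartite_digraph 3 3 (with_proj G) \<and> (\<forall>v \<in> pverts G. \<chi> v = {})"
    (is "?L \<longleftrightarrow> ?R")
proof
  assume ?L
  then obtain xs where xs: "distinct xs" "length xs = num_verts K33" "G = graph_of K33 xs"
    "map \<chi> xs \<in> normal_colorings q K33"
    by (rule copiesE)
  moreover obtain a b c d e f where "xs = [a,b,c,d,e,f]" using xs(2)
    by (auto simp: numeral_eq_Suc length_Suc_conv)
  moreover from calculation have "complete_bipartite_digraph 3 3 (with_proj G)" unfolding K33_iff
    by blast
  ultimately show ?R by simp
next
  assume R: ?R
  then obtain a b c d e f where "distinct [a,b,c,d,e,f]" "G = graph_of K33 [a,b,c,d,e,f]"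
    unfolding K33_iff by auto
  then show ?L using R by (intro copiesI[of "[a,b,c,d,e,f]"]) auto
qed

text \<open>Exchanging the two ends of the deleted edge leaves the graph unchanged, so the smaller
  color can be listed first.\<close>

lemma copies_K5_minus:
  assumes "palette (G, \<chi>) \<subseteq> {1..q}"
  shows "(G, \<chi>) \<in> copies q K5_minus \<longleftrightarrow>
    minus_edge (\<lambda>H. complete_digraph 5 (with_proj H)) G \<and> colors_at_degree 3 1 (G, \<chi>)"
    (is "?L \<longleftrightarrow> ?R")
proof
  assume ?L
  then obtain xs where xs: "distinct xs" "length xs = num_verts K5_minus" "G = graph_of K5_minus xs"
    "map \<chi> xs \<in> normal_colorings q K5_minus"
    by (rule copiesE)
  moreover obtain a b c d e where l: "xs = [a,b,c,d,e]" using xs(2)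
    by (auto simp: numeral_eq_Suc length_Suc_conv)
  moreover from calculation have "minus_edge (\<lambda>H. complete_digraph 5 (with_proj H)) G"
    unfolding K5_minus_iff by blast
  ultimately show ?R using degrees_K5_minus[OF xs(1)[unfolded l]]
    by (auto simp: colors_at_degree_def)
next
  assume R: ?R
  then obtain a b c d e where D: "distinct [a,b,c,d,e]" and G: "G = graph_of K5_minus [a,b,c,d,e]"
    unfolding K5_minus_iff by auto
  have e: "\<chi> c = {}" "\<chi> d = {}" "\<chi> e = {}" and 1: "card (\<chi> a) = 1"
    "card (\<chi> b) = 1"
    using R degrees_K5_minus[OF D] by (auto simp: colors_at_degree_def G)
  obtain i j where ij: "\<chi> a = {i}" "i \<in> {1..q}" "\<chi> b = {j}" "j \<in> {1..q}"
    using 1 assms card_1_subset[of "\<chi> a" q] card_1_subset[of "\<chi> b" q]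
    unfolding palette_subset by (auto simp: G)
  have sw: "G = graph_of K5_minus [b,a,c,d,e]" by (auto simp: G graph_of_def)
  show ?L
  proof (cases "i \<le> j")
    case True
    then show ?thesis using D e ij by (intro copiesI[of "[a,b,c,d,e]"]) (auto simp: G image_iff)
  next
    case False
    then show ?thesis using D e ij sw by (intro copiesI[of "[b,a,c,d,e]"]) (auto simp: image_iff)
  qed
qed

lemma copies_K33_minus:
  assumes "palette (G, \<chi>) \<subseteq> {1..q}"
  shows "(G, \<chi>) \<in> copies q K33_minus \<longleftrightarrow>
    minus_edge (\<lambda>H. complete_bipartite_digraph 3 3 (with_proj H)) G \<and> colors_at_degree 2 1 (G, \<chi>)"
    (is "?L \<longleftrightarrow> ?R")
proof
  assume ?L
  then obtain xs where xs: "distinct xs" "length xs = num_verts K33_minus"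
    "G = graph_of K33_minus xs" "map \<chi> xs \<in> normal_colorings q K33_minus"
    by (rule copiesE)
  moreover obtain a b c d e f where l: "xs = [a,b,c,d,e,f]" using xs(2)
    by (auto simp: numeral_eq_Suc length_Suc_conv)
  moreover from calculation have "minus_edge (\<lambda>H. complete_bipartite_digraph 3 3 (with_proj H)) G" unfolding K33_minus_iff by blast
  ultimately show ?R using degrees_K33_minus[OF xs(1)[unfolded l]]
    by (auto simp: colors_at_degree_def)
next
  assume R: ?R
  then obtain a b c d e f where D: "distinct [a,b,c,d,e,f]"
    and G: "G = graph_of K33_minus [a,b,c,d,e,f]" unfolding K33_minus_iff by auto
  have e: "\<chi> c = {}" "\<chi> d = {}" "\<chi> e = {}" "\<chi> f = {}"
    and 1: "card (\<chi> a) = 1" "card (\<chi> b) = 1"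
    using R degrees_K33_minus[OF D] by (auto simp: colors_at_degree_def G)
  obtain i j where ij: "\<chi> a = {i}" "i \<in> {1..q}" "\<chi> b = {j}" "j \<in> {1..q}"
    using 1 assms card_1_subset[of "\<chi> a" q] card_1_subset[of "\<chi> b" q]
    unfolding palette_subset by (auto simp: G)
  \<comment> \<open>The ends a and b of the deleted edge lie on opposite sides, so exchanging them
    is an automorphism only if the remaining vertices c, d and e, f of the two sides are exchanged
    too.\<close>
  have sw: "G = graph_of K33_minus [b,a,e,f,c,d]" by (auto simp: G graph_of_def)
  show ?L
  proof (cases "i \<le> j")
    case True
    then show ?thesis using D e ij by (intro copiesI[of "[a,b,c,d,e,f]"]) (auto simp: G image_iff)
  next
    case False
    then show ?thesis using D e ij sw by (intro copiesI[of "[b,a,e,f,c,d]"]) (auto simp: image_iff)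
  qed
qed

text \<open>Among three singleton palettes with at most two colors two coincide. All permutations of
  the degree-2 vertices are automorphisms, so the coinciding pair can be listed first.\<close>

lemma copies_K23:
  assumes "palette (G, \<chi>) \<subseteq> {1..q}"
  shows "(G, \<chi>) \<in> copies q K23 \<longleftrightarrow>
    complete_bipartite_digraph 2 3 (with_proj G) \<and> colors_at_degree 2 1 (G, \<chi>) \<and> card (palette (G, \<chi>)) \<le> 2"
    (is "?L \<longleftrightarrow> ?R")
proof
  assume L: ?L
  then obtain xs where xs: "distinct xs" "length xs = num_verts K23" "G = graph_of K23 xs"
    "map \<chi> xs \<in> normal_colorings q K23"
    by (rule copiesE)
  moreover obtain a b c d e where l: "xs = [a,b,c,d,e]" using xs(2)
    by (auto simp: numeral_eq_Suc length_Suc_conv)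
  moreover from calculation have "complete_bipartite_digraph 2 3 (with_proj G)" unfolding K23_iff
    by blast
  ultimately show ?R using degrees_K23[OF xs(1)[unfolded l]] copies_palette_card[OF L]
    by (auto simp: colors_at_degree_def)
next
  assume R: ?R
  then obtain a b c d e where D: "distinct [a,b,c,d,e]" and G: "G = graph_of K23 [a,b,c,d,e]"
    unfolding K23_iff by auto
  have e: "\<chi> d = {}" "\<chi> e = {}" and 1: "card (\<chi> a) = 1" "card (\<chi> b) = 1"
    "card (\<chi> c) = 1"
    using R degrees_K23[OF D] by (auto simp: colors_at_degree_def G)
  obtain i j k where ij: "\<chi> a = {i}" "i \<in> {1..q}" "\<chi> b = {j}" "j \<in> {1..q}"
    "\<chi> c = {k}" "k \<in> {1..q}"
    using 1 assms card_1_subset[of "\<chi> a" q] card_1_subset[of "\<chi> b" q]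
    card_1_subset[of "\<chi> c" q]
    unfolding palette_subset by (auto simp: G)
  have "palette (G, \<chi>) = {i, j, k}" by (auto simp: G palette_graph_of ij e)
  then consider "i = j" | "i = k" | "j = k" using R card_le_2_eq[of "{i,j,k}" i j k] by auto
  then show ?L
  proof cases
    case 1
    then show ?thesis using D e ij by (intro copiesI[of "[a,b,c,d,e]"]) (auto simp: G image_iff)
  next
    case 2
    then show ?thesis using D e ij
      by (intro copiesI[of "[a,c,b,d,e]"]) (auto simp: G image_iff, auto simp: graph_of_def)
  next
    case 3
    then show ?thesis using D e ij
      by (intro copiesI[of "[b,c,a,d,e]"]) (auto simp: G image_iff, auto simp: graph_of_def)
  qed
qed

text \<open>Only d can carry a color other than i. In a two-two coloring one of the two distinct
  colors differs from i and occurs on two vertices, and both would have to be d.\<close>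

lemma not_two_two_K4:
  assumes "distinct [a, b, c, d]" "\<chi> a = {i}" "\<chi> b = {i}" "\<chi> c = {i}"
    "\<chi> d = {j}" "pverts G = {a, b, c, d}"
  shows "\<not> two_two_K4 (G, \<chi>)"
proof
  assume "two_two_K4 (G, \<chi>)"
  then obtain a' b' c' d' i' j' where
    *: "distinct [a', b', c', d']" "pverts G = {a', b', c', d'}" "i' \<noteq> j'"
      "\<chi> a' = {i'}" "\<chi> b' = {i'}" "\<chi> c' = {j'}" "\<chi> d' = {j'}"
    unfolding two_two_K4_def by blast
  have mem: "v = d \<or> \<chi> v = {i}" if "v \<in> pverts G" for v using that assms by auto
  have "a' = d \<or> \<chi> a' = {i}" "b' = d \<or> \<chi> b' = {i}" "c' = d \<or> \<chi> c' = {i}"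
    "d' = d \<or> \<chi> d' = {i}"
    by (rule mem; simp add: *(2))+
  then show False using * by auto
qed

lemma copies_K4:
  assumes "palette (G, \<chi>) \<subseteq> {1..q}"
  shows "(G, \<chi>) \<in> copies q K4 \<longleftrightarrow> complete_digraph 4 (with_proj G) \<and> colors_everywhere 1 (G, \<chi>)
    \<and> card (palette (G, \<chi>)) \<le> 2 \<and> \<not> two_two_K4 (G, \<chi>)"
    (is "?L \<longleftrightarrow> ?R")
proof
  assume L: ?L
  then obtain xs where xs: "distinct xs" "length xs = num_verts K4" "G = graph_of K4 xs"
    "map \<chi> xs \<in> normal_colorings q K4"
    by (rule copiesE)
  then have "complete_digraph 4 (with_proj G)" using complete_graph_of[of xs K4] by simp
  moreover obtain a b c d where l: "xs = [a,b,c,d]" using xs(2)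
    by (auto simp: numeral_eq_Suc length_Suc_conv)
  moreover from xs(4) l obtain i j where "\<chi> a = {i}" "\<chi> b = {i}" "\<chi> c = {i}"
    "\<chi> d = {j}" by auto
  ultimately show ?R using xs(1,3) copies_palette_card[OF L] not_two_two_K4[of a b c d \<chi> i j G]
    by (auto simp: colors_everywhere_def)
next
  assume R: ?R
  then obtain xs where xs: "set xs = pverts G" "distinct xs" "length xs = 4"
    using complete_digraph_enum by blast
  then obtain a b c d where l: "xs = [a,b,c,d]" by (auto simp: numeral_eq_Suc length_Suc_conv)
  have V: "pverts G = {a,b,c,d}" using xs(1) l by simp
  obtain i j k m where ij: "\<chi> a = {i}" "i \<in> {1..q}" "\<chi> b = {j}" "j \<in> {1..q}"
    "\<chi> c = {k}" "k \<in> {1..q}" "\<chi> d = {m}" "m \<in> {1..q}"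
    using R assms card_1_subset[of "\<chi> a" q] card_1_subset[of "\<chi> b" q]
    card_1_subset[of "\<chi> c" q] card_1_subset[of "\<chi> d" q]
    unfolding palette_subset by (auto simp: V colors_everywhere_def)
  have "palette (G, \<chi>) = {i, j, k, m}" by (auto simp: V palette_def ij)
  then have p: "card {i, j, k, m} \<le> 2" using R by simp
  \<comment> \<open>Completeness of G admits every order of the vertices, so it suffices to find
    three of them with equal palettes.\<close>
  have ex: ?L if "distinct [w,x,y,z]" "pverts G = {w,x,y,z}" "\<chi> w = {r}" "\<chi> x = {r}"
    "\<chi> y = {r}" "\<chi> z = {s}"
      "r \<in> {1..q}" "s \<in> {1..q}" for w x y z r s
  proof -
    have "G = graph_of K4 [w,x,y,z]" using complete_eq_graph_of[of K4 G "[w,x,y,z]"] R that by simp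
    then show ?L using that copiesI[of "[w,x,y,z]" K4 G \<chi> q] by (auto simp: image_iff)
  qed
  \<comment> \<open>Every three of the four vertices contain a coinciding pair. This leaves either
    three equal colors or one of the three ways to split four vertices into two monochromatic pairs,
    and those are refuted next.\<close>
  have "i = j \<or> i = k \<or> j = k" "i = j \<or> i = m \<or> j = m"
    "i = k \<or> i = m \<or> k = m" "j = k \<or> j = m \<or> k = m"
    by (rule card_le_2_eq[OF p]; simp)+
  moreover have nt: False if "distinct [w,x,y,z]" "pverts G = {w,x,y,z}" "r \<noteq> s"
    "\<chi> w = {r}" "\<chi> x = {r}" "\<chi> y = {s}" "\<chi> z = {s}"
    for w x y z r s using R that unfolding two_two_K4_def by blast
  moreover have "\<not> (i = j \<and> k = m \<and> i \<noteq> k)"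
    "\<not> (i = k \<and> j = m \<and> i \<noteq> j)"
      "\<not> (i = m \<and> j = k \<and> i \<noteq> j)"
    using nt[of a b c d i k] nt[of a c b d i j] nt[of a d b c i j] xs(2) V ij unfolding l by auto
  ultimately consider "i = j" "j = k" | "i = j" "j = m" | "i = k" "k = m" | "j = k" "k = m" by blast
  then show ?L
  proof cases
    case 1 then show ?thesis using ex[of a b c d i m] V xs(2) ij unfolding l by simp
  next
    case 2 then show ?thesis using ex[of a b d c i k] V xs(2) ij unfolding l
      by (auto simp: insert_commute)
  next
    case 3 then show ?thesis using ex[of a c d b i j] V xs(2) ij unfolding l
      by (auto simp: insert_commute)
  next
    case 4 then show ?thesis using ex[of b c d a j i] V xs(2) ij unfolding l
      by (auto simp: insert_commute)
  qed
qed

lemma is_cycle4_iff: "is_cycle4 a b c d G \<longleftrightarrow> distinct [a,b,c,d] \<and> G = graph_of C4 [a,b,c,d]"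
  by (cases G) (auto simp: is_cycle4_def graph_of_def)

text \<open>Both opposite pairs carry a color and share none, so with two colors each pair is
  monochromatic. Rotating the cycle by one step exchanges the pairs, so the smaller color can be
  listed first.\<close>

lemma copies_C4:
  assumes "palette (G, \<chi>) \<subseteq> {1..q}"
  shows "(G, \<chi>) \<in> copies q C4 \<longleftrightarrow> (\<exists>a b c d. is_cycle4 a b c d G \<and> colors_everywhere 1 (G, \<chi>) \<and>
         (\<chi> a \<union> \<chi> c) \<inter> (\<chi> b \<union> \<chi> d) = {}) \<and> card (palette (G, \<chi>)) \<le> 2"
    (is "?L \<longleftrightarrow> ?R")
proof
  assume L: ?L
  then obtain xs where xs: "distinct xs" "length xs = num_verts C4" "G = graph_of C4 xs"
    "map \<chi> xs \<in> normal_colorings q C4"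
    by (rule copiesE)
  moreover obtain a b c d where l: "xs = [a,b,c,d]" using xs(2)
    by (auto simp: numeral_eq_Suc length_Suc_conv)
  ultimately have "is_cycle4 a b c d G" "colors_everywhere 1 (G, \<chi>)"
    "(\<chi> a \<union> \<chi> c) \<inter> (\<chi> b \<union> \<chi> d) = {}"
    by (auto simp: is_cycle4_iff colors_everywhere_def)
  then show ?R using copies_palette_card[OF L] by blast
next
  assume R: ?R
  then obtain a b c d where *: "distinct [a,b,c,d]" "G = graph_of C4 [a,b,c,d]"
    "colors_everywhere 1 (G, \<chi>)"
         "(\<chi> a \<union> \<chi> c) \<inter> (\<chi> b \<union> \<chi> d) = {}"
           unfolding is_cycle4_iff by blast
  obtain i j k m where ij: "\<chi> a = {i}" "i \<in> {1..q}" "\<chi> b = {j}" "j \<in> {1..q}"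
    "\<chi> c = {k}" "k \<in> {1..q}" "\<chi> d = {m}" "m \<in> {1..q}"
    using * assms card_1_subset[of "\<chi> a" q] card_1_subset[of "\<chi> b" q]
    card_1_subset[of "\<chi> c" q] card_1_subset[of "\<chi> d" q]
    unfolding palette_subset by (auto simp: colors_everywhere_def)
  have "palette (G, \<chi>) = {i, j, k, m}" by (auto simp: * palette_graph_of ij)
  then have p: "card {i, j, k, m} \<le> 2" using R by simp
  have "i = j \<or> i = k \<or> j = k" "i = j \<or> i = m \<or> j = m"
    by (rule card_le_2_eq[OF p]; simp)+
  then have eq: "k = i" "m = j" "i \<noteq> j" using *(4) ij by auto
  have sw: "graph_of C4 [a,b,c,d] = graph_of C4 [b,c,d,a]" by (auto simp: graph_of_def)
  show ?L
  proof (cases "i < j")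
    case True
    then show ?thesis using * ij eq by (intro copiesI[of "[a,b,c,d]"]) (auto simp: image_iff)
  next
    case False
    then show ?thesis using * ij eq sw by (intro copiesI[of "[b,c,d,a]"]) (auto simp: image_iff)
  qed
qed

text \<open>A vertex with as many colors as the whole graph carries all of them. On
  \<open>K3\<close> and \<open>K13\<close> this makes the palettes of all colored vertices equal, so
  every admissible listing is already normal.\<close>

lemma palette_full:
  assumes "palette (G, \<chi>) \<subseteq> {1..q}"
    "card (palette (G, \<chi>)) \<le> card (\<chi> v)" "v \<in> pverts G"
  shows "\<chi> v = palette (G, \<chi>)"
  using assms by (intro card_seteq) (auto simp: palette_def intro: finite_subset)

lemma copies_K3:
  assumes "palette (G, \<chi>) \<subseteq> {1..q}"
  shows "(G, \<chi>) \<in> copies q K3 \<longleftrightarrow> complete_digraph 3 (with_proj G) \<and> colors_everywhere 2 (G, \<chi>)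
    \<and> card (palette (G, \<chi>)) \<le> 2"
    (is "?L \<longleftrightarrow> ?R")
proof
  assume L: ?L
  then obtain xs where xs: "distinct xs" "length xs = num_verts K3" "G = graph_of K3 xs"
    "map \<chi> xs \<in> normal_colorings q K3"
    by (rule copiesE)
  then have "complete_digraph 3 (with_proj G)" using complete_graph_of[of xs K3] by simp
  moreover obtain a b c where l: "xs = [a,b,c]" using xs(2)
    by (auto simp: numeral_eq_Suc length_Suc_conv)
  ultimately show ?R using xs(3,4) copies_palette_card[OF L]
    by (auto simp: colors_everywhere_def)
next
  assume R: ?R
  then obtain xs where xs: "set xs = pverts G" "distinct xs" "length xs = 3"
    using complete_digraph_enum by blast
  then obtain a b c where l: "xs = [a,b,c]" by (auto simp: numeral_eq_Suc length_Suc_conv)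
  have V: "pverts G = {a,b,c}" using xs(1) l by simp
  have "G = graph_of K3 [a,b,c]" using complete_eq_graph_of[of K3 G xs] R xs l by simp
  moreover have "\<chi> a = palette (G, \<chi>)" "\<chi> b = palette (G, \<chi>)"
    "\<chi> c = palette (G, \<chi>)" "card (\<chi> a) = 2"
    using R by (auto intro!: palette_full[OF assms] simp: V colors_everywhere_def)
  ultimately show ?L using xs(2) l assms by (intro copiesI[of xs]) (auto simp: image_iff)
qed

lemma copies_K13:
  assumes "palette (G, \<chi>) \<subseteq> {1..q}"
  shows "(G, \<chi>) \<in> copies q K13 \<longleftrightarrow> complete_bipartite_digraph 1 3 (with_proj G) \<and> colors_at_degree 1 2 (G, \<chi>)
    \<and> card (palette (G, \<chi>)) \<le> 2"
    (is "?L \<longleftrightarrow> ?R")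
proof
  assume L: ?L
  then obtain xs where xs: "distinct xs" "length xs = num_verts K13" "G = graph_of K13 xs"
    "map \<chi> xs \<in> normal_colorings q K13"
    by (rule copiesE)
  moreover obtain a b c d where l: "xs = [a,b,c,d]" using xs(2)
    by (auto simp: numeral_eq_Suc length_Suc_conv)
  moreover from calculation have "complete_bipartite_digraph 1 3 (with_proj G)" unfolding K13_iff
    by blast
  ultimately show ?R using copies_palette_card[OF L] degrees_K13[OF xs(1)[unfolded l]]
    by (auto simp: colors_at_degree_def)
next
  assume R: ?R
  then obtain a b c d where D: "distinct [a,b,c,d]" and G: "G = graph_of K13 [a,b,c,d]"
    unfolding K13_iff by auto
  have e: "\<chi> d = {}" and 2: "card (\<chi> a) = 2" "card (\<chi> b) = 2" "card (\<chi> c) = 2"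
    using R degrees_K13[OF D] by (auto simp: colors_at_degree_def G)
  have "\<chi> a = palette (G, \<chi>)" "\<chi> b = palette (G, \<chi>)"
    "\<chi> c = palette (G, \<chi>)"
    using R 2 by (intro palette_full[OF assms]; simp add: G)+
  then show ?L using D G e 2 assms by (intro copiesI[of "[a,b,c,d]"]) (auto simp: image_iff)
qed

lemma copies_K1:
  assumes "palette (G, \<chi>) \<subseteq> {1..q}"
  shows "(G, \<chi>) \<in> copies q K1 \<longleftrightarrow> complete_digraph 1 (with_proj G) \<and> colors_everywhere 3 (G, \<chi>)"
    (is "?L \<longleftrightarrow> ?R")
proof
  assume L: ?L
  then obtain xs where xs: "distinct xs" "length xs = num_verts K1" "G = graph_of K1 xs"
    "map \<chi> xs \<in> normal_colorings q K1"
    by (rule copiesE)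
  then have "complete_digraph 1 (with_proj G)" using complete_graph_of[of xs K1] by simp
  moreover obtain a where l: "xs = [a]" using xs(2) by (auto simp: length_Suc_conv)
  ultimately show ?R using xs(3,4) by (auto simp: colors_everywhere_def)
next
  assume R: ?R
  then obtain xs where xs: "set xs = pverts G" "distinct xs" "length xs = 1"
    using complete_digraph_enum by blast
  then obtain a where l: "xs = [a]" by (auto simp: length_Suc_conv)
  have "G = graph_of K1 [a]" using complete_eq_graph_of[of K1 G xs] R xs l by simp
  moreover from this have "\<chi> a \<subseteq> {1..q}" "card (\<chi> a) = 3"
    using assms R unfolding palette_subset colors_everywhere_def by simp_all
  ultimately show ?L by (intro copiesI[of "[a]"]) simp_all
qed

lemma copies_TwoK1:
  assumes "palette (G, \<chi>) \<subseteq> {1..q}"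
  shows "(G, \<chi>) \<in> copies q TwoK1 \<longleftrightarrow> card (pverts G) = 2 \<and> parcs G = {} \<and>
     colors_everywhere 2 (G, \<chi>) \<and> card (palette (G, \<chi>)) = 4"
    (is "?L \<longleftrightarrow> ?R")
proof
  assume L: ?L
  then obtain xs where xs: "distinct xs" "length xs = num_verts TwoK1" "G = graph_of TwoK1 xs"
    "map \<chi> xs \<in> normal_colorings q TwoK1"
    by (rule copiesE)
  moreover obtain a b where l: "xs = [a,b]" using xs(2)
    by (auto simp: numeral_eq_Suc length_Suc_conv)
  moreover have "card (\<chi> a \<union> \<chi> b) = 4" using xs(4) l
    by (subst card_Un_disjoint) (auto simp: disjoint_pairs_def intro: finite_subset)
  ultimately show ?R by
    (auto simp: disjoint_pairs_def colors_everywhere_def graph_of_def palette_def)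
next
  assume R: ?R
  then obtain a b where V: "pverts G = {a,b}" "a \<noteq> b" by (auto simp: card_2_iff)
  have G: "G = graph_of TwoK1 [a,b]" using V R by (cases G) (simp add: graph_of_def)
  then have G': "G = graph_of TwoK1 [b,a]" by (simp add: graph_of_def insert_commute)
  have c: "card (\<chi> a) = 2" "card (\<chi> b) = 2" using R V
    by (auto simp: colors_everywhere_def)
  have p: "\<chi> a \<union> \<chi> b = palette (G, \<chi>)" by (simp add: palette_def V)
  have s: "\<chi> a \<subseteq> {1..q}" "\<chi> b \<subseteq> {1..q}" using p assms by auto
  then have f: "finite (\<chi> a)" "finite (\<chi> b)" by (auto intro: finite_subset)
  \<comment> \<open>By inclusion-exclusion, 2 + 2 = 4 leaves nothing for the intersection;
    disjointness then separates the minima, and the smaller one decides the order of the two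
    vertices.\<close>
  then have i: "\<chi> a \<inter> \<chi> b = {}" using card_Un_Int[OF f] c p R by simp
  have "Min (\<chi> a) \<in> \<chi> a" "Min (\<chi> b) \<in> \<chi> b" using f c
    by (auto intro!: Min_in)
  then have "Min (\<chi> a) \<noteq> Min (\<chi> b)" using i by auto
  then consider "Min (\<chi> a) < Min (\<chi> b)" | "Min (\<chi> b) < Min (\<chi> a)" by linarith
  then show ?L
  proof cases
    case 1
    then show ?thesis using V(2) G s c i
      by (intro copiesI[of "[a,b]"]) (auto simp: disjoint_pairs_def image_iff)
  next
    case 2
    then show ?thesis using V(2) G' s c i
      by (intro copiesI[of "[b,a]"]) (auto simp: disjoint_pairs_def image_iff)
  qed
qed

section \<open>The obstructions over q colors as the union of the families\<close>

lemma colorful_graph_iff: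
  assumes "palette (G, \<chi>) \<subseteq> {1..q}"
  shows "colorful_graph (G, \<chi>) \<longleftrightarrow> pair_graph G"
proof -
  have "finite (\<chi> v) \<and> (\<forall>i \<in> \<chi> v. 0 < i)" if "v \<in> pverts G" for v
  proof -
    have "\<chi> v \<subseteq> {1..q}" using assms that unfolding palette_subset by blast
    then show ?thesis using finite_subset[of "\<chi> v" "{1..q}"] by fastforce
  qed
  then show ?thesis by (simp add: colorful_graph_def)
qed

lemma two_two_K4_card: "two_two_K4 (G, \<chi>) \<Longrightarrow> card (pverts G) = 4"
  by (auto simp: two_two_K4_def complete_digraph_def)

lemma UNIV_shape: "UNIV = {K5, K33, K5_minus, K4, K33_minus, K23, C4, K3, K13, K1, TwoK1}"
  using shape.exhaust by blast

lemma ex_shape: "(\<exists>s. P s) \<longleftrightarrow> P K5 \<or> P K33 \<or> P K5_minus \<or> P K4 \<or> P K33_minus \<or> P K23 \<or> P C4 \<or> P K3 \<or>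
    P K13 \<or> P K1 \<or> P TwoK1"
proof -
  have "(\<exists>s. P s) \<longleftrightarrow> (\<exists>s \<in> UNIV. P s)" by simp
  then show ?thesis unfolding UNIV_shape by simp
qed

text \<open>Both sides contain only palettes inside \<open>{1..q}\<close>, and this inclusion is a
  premise of most of the family lemmas; the other case is therefore settled beforehand, and the
  families are then matched one by one.\<close>

lemma Obs_upto_eq: "(Obs_upto q :: 'v colored set) = (\<Union>s. copies q s)"
proof (rule set_eqI)
  fix X :: "'v colored"
  obtain G \<chi> where X: "X = (G, \<chi>)" by (cases X)
  show "X \<in> Obs_upto q \<longleftrightarrow> X \<in> (\<Union>s. copies q s)"
  proof (cases "palette (G, \<chi>) \<subseteq> {1..q}")
    case False
    then show ?thesis using copies_palette[of G \<chi> q]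
      by (auto simp: Obs_upto_def X simp del: atLeastAtMost_iff)
  next
    case True
    have pg: "pair_graph G" if "(G, \<chi>) \<in> copies q s" for s using that
      by (rule copies_pair_graph)
    \<comment> \<open>\<open>Obs1_tilde\<close> tests every graph of \<open>Obs1\<close> for a
      two-two coloring; for graphs other than \<open>K4\<close> the number of vertices gives the
      answer.\<close>
    have t: "\<not> two_two_K4 (G, \<chi>)" if "(G, \<chi>) \<in> copies q s"
      "num_verts s \<noteq> 4" for s
      using two_two_K4_card card_verts_copies that by metis
    \<comment> \<open>The bound of \<open>Obs1_tilde\<close> on the palette also concerns the
      minus-edge graphs, where it is automatic: only two vertices carry a color, one each.\<close>
    have c: "card (palette (G, \<chi>)) \<le> 2" if "(G, \<chi>) \<in> copies q s" "s \<noteq> K1"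
      "s \<noteq> TwoK1" for s
      using that by (rule copies_palette_card)
    note iffs = copies_K5 copies_K33 copies_K5_minus[OF True] copies_K4[OF True]
      copies_K33_minus[OF True] copies_K23[OF True] copies_C4[OF True] copies_K3[OF True]
      copies_K13[OF True] copies_K1[OF True] copies_TwoK1[OF True]
    have 0: "X \<in> Obs0 \<longleftrightarrow> X \<in> copies q K5 \<or> X \<in> copies q K33"
      using pg[of K5] pg[of K33] unfolding X iffs
      by (auto simp: Obs0_def colorful_graph_iff[OF True])
    have 1: "X \<in> Obs1_tilde \<longleftrightarrow> X \<in> copies q K5_minus \<or> X \<in> copies q K4 \<or> X \<in> copies q K33_minus \<or> X \<in> copies q K23"
      using pg[of K5_minus] pg[of K4] pg[of K33_minus] pg[of K23] t[of K5_minus] t[of K33_minus]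
      t[of K23] c[of K5_minus] c[of K33_minus]
      unfolding X iffs by (auto simp: Obs1_tilde_def Obs1_def colorful_graph_iff[OF True])
    have 2: "X \<in> Obs2_tilde \<longleftrightarrow> X \<in> copies q C4 \<or> X \<in> copies q K3 \<or> X \<in> copies q K13"
      using pg[of C4] pg[of K3] pg[of K13]
      unfolding X iffs by (auto simp: Obs2_tilde_def Obs2_def colorful_graph_iff[OF True])
    have 3: "X \<in> Obs3 \<longleftrightarrow> X \<in> copies q K1"
      using pg[of K1] unfolding X iffs by (auto simp: Obs3_def colorful_graph_iff[OF True])
    have 4: "X \<in> Obs4 \<longleftrightarrow> X \<in> copies q TwoK1"
      using pg[of TwoK1] unfolding X iffs by (auto simp: Obs4_def colorful_graph_iff[OF True])
    have "X \<in> Obs_upto q \<longleftrightarrow> X \<in> Obs" using True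
      by (simp add: Obs_upto_def X)
    also have "\<dots> \<longleftrightarrow> (\<exists>s. X \<in> copies q s)"
      unfolding Obs_def Un_iff 0 1 2 3 4 ex_shape by argo
    finally show ?thesis by simp
  qed
qed

subsection \<open>Templates represent the isomorphism classes uniquely\<close>

definition template :: "shape \<times> nat set list \<Rightarrow> nat colored" where
  "template = (\<lambda>(s, cs). (graph_of s [0..<length cs], (!) cs))"

definition normal_codes :: "nat \<Rightarrow> (shape \<times> nat set list) set" where
  "normal_codes q = (SIGMA s:UNIV. normal_colorings q s)"

lemma length_normal_colorings:
  "cs \<in> normal_colorings q s \<Longrightarrow> length cs = num_verts s"
  by (cases s) auto

lemma template_in_copies:
  assumes "cs \<in> normal_colorings q s"
  shows "template (s, cs) \<in> copies q s"
proof -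
  have "map ((!) cs) [0..<length cs] \<in> normal_colorings q s" using assms by (simp only: map_nth)
  then show ?thesis unfolding template_def split
    by (rule copiesI[rotated 3]) (simp_all add: length_normal_colorings[OF assms])
qed

text \<open>Distinctness makes vertices and positions interchangeable, so adjacency depends on the
  shape and the two positions alone. This is why position lookup preserves arcs.\<close>

lemma arc_graph_of:
  assumes "distinct xs" "length xs = num_verts s" "i < num_verts s" "j < num_verts s"
  shows "(xs ! i, xs ! j) \<in> parcs (graph_of s xs) \<longleftrightarrow> (i, j) \<in> set (edges s) \<or> (j, i) \<in> set (edges s)"
proof -
  have "(k, l) \<in> set (edges s) \<Longrightarrow> k < length xs \<and> l < length xs" for k l
    using edges_less assms by metis
  then show ?thesis using assms by (fastforce simp: graph_of_def nth_eq_iff_index_eq)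
qed

text \<open>The isomorphism sends each vertex to its position in a listing with normal palette list;
  that palette list is the code of the template.\<close>

lemma copies_iso_template:
  assumes "X \<in> copies q s"
  obtains cs where "cs \<in> normal_colorings q s" "colorful_iso X (template (s, cs))"
proof -
  obtain G \<chi> where X: "X = (G, \<chi>)" by (cases X)
  obtain xs where xs: "distinct xs" "length xs = num_verts s" "G = graph_of s xs"
    "map \<chi> xs \<in> normal_colorings q s"
    using assms unfolding X by (rule copiesE)
  let ?n = "num_verts s"
  have p: "pair_graph G" "pair_graph (graph_of s [0..<?n])" using xs
    by (auto intro: pair_graph_graph_of)
  define f where "f = the_inv_into {..<?n} ((!) xs)"
  have b: "bij_betw ((!) xs) {..<?n} (set xs)" using xs by (simp add: bij_betw_nth)
  have f: "f (xs ! i) = i" if "i < ?n" for i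
    unfolding f_def using b that by (intro the_inv_into_f_f) (auto simp: bij_betw_def)
  have "bij_betw f (pverts G) (pverts (graph_of s [0..<?n]))"
    unfolding f_def using bij_betw_the_inv_into[OF b] by (simp add: xs(3) atLeast0LessThan)
  moreover have "(u, v) \<in> parcs G \<longleftrightarrow> (f u, f v) \<in> parcs (graph_of s [0..<?n])"
    if "u \<in> pverts G" "v \<in> pverts G" for u v
  proof -
    obtain i j where ij: "u = xs ! i" "v = xs ! j" "i < ?n" "j < ?n"
      using \<open>u \<in> _\<close> \<open>v \<in> _\<close> xs(2,3)
      by (auto simp: in_set_conv_nth)
    show ?thesis using arc_graph_of[OF xs(1,2), of i j] arc_graph_of[of "[0..<?n]" s i j] ij f
      by (simp add: xs(3))
  qed
  moreover have "map \<chi> xs ! f v = \<chi> v" if "v \<in> pverts G" for v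
    using that xs f by (auto simp: in_set_conv_nth)
  ultimately have "colorful_iso X (template (s, map \<chi> xs))"
    unfolding X template_def using colorful_iso_iff[OF p] xs(2) by auto
  then show ?thesis using that xs(4) by blast
qed

lemma colorful_iso_invariants:
  assumes "colorful_iso (G, \<chi>) (H, \<psi>)" "pair_graph G" "pair_graph H"
  shows "card (pverts G) = card (pverts H)" "card (parcs G) = card (parcs H)"
    "image_mset \<chi> (mset_set (pverts G)) = image_mset \<psi> (mset_set (pverts H))"
proof -
  interpret G: pair_graph G by fact
  interpret H: pair_graph H by fact
  obtain f where f: "bij_betw f (pverts G) (pverts H)"
    and a: "\<And>u v. u \<in> pverts G \<Longrightarrow> v \<in> pverts G \<Longrightarrow> (u, v) \<in> parcs G \<longleftrightarrow> (f u, f v) \<in> parcs H"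
    and c: "\<And>v. v \<in> pverts G \<Longrightarrow> \<psi> (f v) = \<chi> v"
    using assms(1) colorful_iso_iff[OF assms(2,3)] by auto
  show "card (pverts G) = card (pverts H)" using f by (rule bij_betw_same_card)
  have inj: "inj_on f (pverts G)" and im: "f ` pverts G = pverts H" using f
    by (auto simp: bij_betw_def)
  have "image_mset \<psi> (mset_set (pverts H)) = image_mset (\<psi> \<circ> f) (mset_set (pverts G))"
    unfolding im[symmetric] image_mset_mset_set[OF inj, symmetric] by (simp add: multiset.map_comp)
  also have "\<dots> = image_mset \<chi> (mset_set (pverts G))"
    by (rule image_mset_cong) (use c G.pair_finite_verts in auto)
  finally show "image_mset \<chi> (mset_set (pverts G)) = image_mset \<psi> (mset_set (pverts H))" ..
  have "inj_on (map_prod f f) (parcs G)"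
    by (rule inj_on_subset[OF map_prod_inj_on[OF inj inj]]) (auto dest: G.in_arcsD1 G.in_arcsD2)
  moreover have "map_prod f f ` parcs G = parcs H"
  proof (intro equalityI subsetI)
    fix e assume "e \<in> parcs H"
    moreover from this have "fst e \<in> f ` pverts G" "snd e \<in> f ` pverts G"
      unfolding im by (auto intro: H.arc_fst_in_verts H.arc_snd_in_verts)
    then obtain u v where "u \<in> pverts G" "v \<in> pverts G" "e = (f u, f v)"
      by (metis imageE prod.collapse)
    ultimately show "e \<in> map_prod f f ` parcs G" using a by force
  next
    fix e assume "e \<in> map_prod f f ` parcs G"
    then obtain u v where "e = (f u, f v)" "(u, v) \<in> parcs G" by auto
    then show "e \<in> parcs H" using a G.in_arcsD1 G.in_arcsD2 by metis
  qed
  ultimately show "card (parcs G) = card (parcs H)" by (metis card_image)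
qed

text \<open>The arrangement can be read off the multiset: on \<open>K4\<close> the color i is the
  one on at least three vertices, on \<open>K23\<close> the one on at least two, and wherever two
  entries could be exchanged the inequality between colors or minima fixes their order.\<close>

lemma normal_colorings_eqI_mset:
  assumes "cs \<in> normal_colorings q s" "ds \<in> normal_colorings q s" "mset cs = mset ds"
  shows "cs = ds"
  using assms by (cases s) (auto simp: add_eq_conv_ex disjoint_pairs_def)

lemma card_parcs_graph_of:
  "card (parcs (graph_of s [0..<num_verts s])) = 2 * length (edges s)"
  by (cases s) (auto simp: graph_of_def numeral_eq_Suc)

lemma template_iso_imp_eq:
  assumes "cs \<in> normal_colorings q s" "ds \<in> normal_colorings q t"
    "colorful_iso (template (s, cs)) (template (t, ds))"
  shows "s = t" "cs = ds"
proof -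
  note l = length_normal_colorings[OF assms(1)] length_normal_colorings[OF assms(2)]
  note inv = colorful_iso_invariants[OF assms(3)[unfolded template_def split]]
  have pg: "pair_graph (graph_of s [0..<length cs])" "pair_graph (graph_of t [0..<length ds])"
    using l by (auto intro: pair_graph_graph_of)
  \<comment> \<open>The vertices of a template are the positions of its palette list, so its
    multiset of palettes is the multiset of that list.\<close>
  have m: "image_mset ((!) xs) (mset_set {0..<length xs}) = mset xs" for xs :: "nat set list"
    by (metis map_nth mset_map mset_upt)
  from inv(1,2)[OF pg] have "num_verts s = num_verts t" "length (edges s) = length (edges t)"
    using card_parcs_graph_of[of s] card_parcs_graph_of[of t] by (auto simp: l)
  \<comment> \<open>The numbers of vertices and edges, in the order of the constructors, are (5,10),
    (6,9), (5,9), (4,6), (6,8), (5,6), (4,4), (3,3), (4,3), (1,0), (2,0); no two pairs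
    agree.\<close>
  then show s: "s = t" by (cases s; cases t) auto
  from inv(3)[OF pg] have "mset cs = mset ds" by (simp add: m)
  with assms(1,2) s show "cs = ds" using normal_colorings_eqI_mset by blast
qed

text \<open>Sending a code to the class of its template is a bijection: surjective because every
  obstruction is isomorphic to a template, injective because isomorphic templates have equal
  codes.\<close>

lemma card_Obs_classes: "card (Obs_classes q) = card (normal_codes q)"
proof -
  let ?A = "Obs_upto q :: nat colored set"
  let ?R = "iso_on ?A"
  have "colorful_graph X" if "X \<in> ?A" for X
    using that by (auto simp: Obs_upto_def Obs_def Obs0_def Obs1_tilde_def Obs1_def Obs2_tilde_def Obs2_def Obs3_def Obs4_def)
  then have eq: "equiv ?A ?R" by (rule equiv_iso_on)
  have t: "template c \<in> ?A" if "c \<in> normal_codes q" for c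
    using that template_in_copies by (auto simp: Obs_upto_eq normal_codes_def)
  have "bij_betw (\<lambda>c. ?R `` {template c}) (normal_codes q) (?A // ?R)"
  proof (rule bij_betw_imageI)
    show "inj_on (\<lambda>c. ?R `` {template c}) (normal_codes q)"
    proof (rule inj_onI)
      fix c d assume cd: "c \<in> normal_codes q" "d \<in> normal_codes q"
        "?R `` {template c} = ?R `` {template d}"
      then have "(template c, template d) \<in> ?R" using eq t by (simp add: eq_equiv_class_iff)
      then have "colorful_iso (template c) (template d)" by (simp add: iso_on_def)
      then show "c = d" using cd template_iso_imp_eq
        by (cases c, cases d) (auto simp: normal_codes_def)
    qed
    show "(\<lambda>c. ?R `` {template c}) ` normal_codes q = ?A // ?R"
    proof (intro equalityI subsetI)
      fix Q assume "Q \<in> ?A // ?R"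
      then obtain X where X: "X \<in> ?A" "Q = ?R `` {X}" by (auto elim: quotientE)
      then obtain s where "X \<in> copies q s" by (auto simp: Obs_upto_eq)
      then obtain cs where cs: "cs \<in> normal_colorings q s" "colorful_iso X (template (s, cs))"
        by (rule copies_iso_template)
      then have c: "(s, cs) \<in> normal_codes q" by (simp add: normal_codes_def)
      then have "(X, template (s, cs)) \<in> ?R" using cs X t by (simp add: iso_on_def)
      then have "Q = ?R `` {template (s, cs)}" unfolding X by (rule equiv_class_eq[OF eq])
      then show "Q \<in> (\<lambda>c. ?R `` {template c}) ` normal_codes q" using c by blast
    qed (use t in \<open>auto intro: quotientI\<close>)
  qed
  then show ?thesis unfolding Obs_classes_def by (simp add: bij_betw_same_card)
qed

subsection \<open>Counting\<close>

text \<open>Over the reals no subtraction is truncated, and the formulas hold for small n as well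
  because the products vanish there.\<close>

lemma real_choose:
  "real (n choose 2) = real n * (real n - 1) / 2"
  "real (n choose 3) = real n * (real n - 1) * (real n - 2) / 6"
proof -
  show 2: "real (n choose 2) = real n * (real n - 1) / 2" for n
    by (induction n) (simp_all add: numeral_2_eq_2 field_simps)
  show "real (n choose 3) = real n * (real n - 1) * (real n - 2) / 6"
    by (induction n) (simp_all add: numeral_3_eq_3 2[unfolded numeral_2_eq_2] field_simps)
qed

lemma card_subsets: "card {S. S \<subseteq> {1..q} \<and> card S = k} = q choose k"
  using n_subsets[of "{1..q}" k] by simp

lemma card_le_pairs: "real (card (SIGMA j:{1..q}. {1..j})) = real q * (real q + 1) / 2"
proof -
  have "card (SIGMA j:{1..q}. {1..j}) = (\<Sum>j=1..q. j)" by simp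
  moreover have "real (\<Sum>j=1..q. j) = real q * (real q + 1) / 2"
    by (induction q) (simp_all add: field_simps)
  ultimately show ?thesis by simp
qed

lemma card_less_pairs: "real (card (SIGMA j:{1..q}. {1..<j})) = real q * (real q - 1) / 2"
proof -
  have "card (SIGMA j:{1..q}. {1..<j}) = (\<Sum>j=1..q. j - 1)" by simp
  moreover have "real (\<Sum>j=1..q. j - 1) = real q * (real q - 1) / 2"
    by (induction q) (simp_all add: field_simps)
  ultimately show ?thesis by simp
qed

text \<open>Ordered pairs are counted: one 2-subset is chosen, then another from the remaining q - 2
  colors, and swapping the components halves the count. The value is three times the binomial
  coefficient of q over 4, as four colors split into two pairs in three ways.\<close>

lemma card_disjoint_pairs:
  "real (card (disjoint_pairs q)) = real q * (real q - 1) * (real q - 2) * (real q - 3) / 8"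
proof -
  let ?D = "{S. S \<subseteq> {1..q} \<and> card S = 2}"
  let ?P = "SIGMA S:?D. {T. T \<subseteq> {1..q} - S \<and> card T = 2}"
  have fD: "finite ?D" by simp
  have fP: "finite ?P" by (intro finite_SigmaI fD) (auto intro: finite_subset[of _ "Pow {1..q}"])
  have "card {T. T \<subseteq> {1..q} - S \<and> card T = 2} = (q - 2) choose 2" if "S \<in> ?D"
    for S
  proof -
    have "card ({1..q} - S) = q - 2" using that
      by (subst card_Diff_subset) (auto intro: finite_subset)
    then show ?thesis using n_subsets[of "{1..q} - S" 2] by simp
  qed
  then have "card ?P = (q choose 2) * ((q - 2) choose 2)"
    using fD card_subsets[of q 2]
    by (subst card_SigmaI) (auto intro: finite_subset[of _ "Pow {1..q}"])
  moreover have "card ?P = 2 * card (disjoint_pairs q)"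
  proof -
    have ne: "Min S \<noteq> Min T" if "(S, T) \<in> ?P" for S T
    proof -
      have "finite S" "finite T" "S \<noteq> {}" "T \<noteq> {}" using that
        by (auto intro: finite_subset)
      then have "Min S \<in> S" "Min T \<in> T" by simp_all
      then show ?thesis using that by auto
    qed
    have sub: "disjoint_pairs q \<subseteq> ?P" by (auto simp: disjoint_pairs_def)
    then have fL: "finite (disjoint_pairs q)" using fP by (rule finite_subset)
    \<comment> \<open>The minima differ, so of an ordered pair and its swap exactly one lies in
      \<open>disjoint_pairs q\<close>.\<close>
    have "?P = disjoint_pairs q \<union> prod.swap ` disjoint_pairs q"
    proof (intro equalityI subsetI)
      fix X assume X: "X \<in> ?P"
      then obtain S T where ST: "X = (S, T)" by (cases X)
      then consider "Min S < Min T" | "Min T < Min S" using ne X by force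
      then show "X \<in> disjoint_pairs q \<union> prod.swap ` disjoint_pairs q"
      proof cases
        case 1 then show ?thesis using X ST by (auto simp: disjoint_pairs_def)
      next
        case 2
        then have "(T, S) \<in> disjoint_pairs q" using X ST by (auto simp: disjoint_pairs_def)
        then have "prod.swap (T, S) \<in> prod.swap ` disjoint_pairs q" by (rule imageI)
        then show ?thesis using ST by simp
      qed
    qed (auto simp: disjoint_pairs_def)
    moreover have "disjoint_pairs q \<inter> prod.swap ` disjoint_pairs q = {}"
      by (auto simp: disjoint_pairs_def)
    ultimately have "card ?P = card (disjoint_pairs q) + card (prod.swap ` disjoint_pairs q)"
      using fL by (simp add: card_Un_disjoint)
    then show ?thesis by (simp add: card_image)
  qed
  ultimately have "2 * card (disjoint_pairs q) = (q choose 2) * ((q - 2) choose 2)" by simp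
  then have "2 * real (card (disjoint_pairs q)) = real (q choose 2) * real ((q - 2) choose 2)"
    by (metis of_nat_mult of_nat_numeral)
  also have "\<dots> = real q * (real q - 1) * (real q - 2) * (real q - 3) / 4"
    \<comment> \<open>For q below 2 the natural number q - 2 is truncated, but there both
      \<open>q choose 2\<close> and the product on the right vanish.\<close>
    by (cases "q < 2") (auto simp: real_choose of_nat_diff less_2_cases_iff)
  finally show ?thesis by simp
qed

lemma finite_normal_colorings: "finite (normal_colorings q s)"
proof (cases s)
  case TwoK1
  have "finite (disjoint_pairs q)"
    by (rule finite_subset[of _ "Pow {1..q} \<times> Pow {1..q}"]) (auto simp: disjoint_pairs_def)
  then show ?thesis using TwoK1 by simp
qed auto

text \<open>Apart from the two uncolored shapes, each set is the image of an index set under an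
  injective parametrization, so the index sets are what is counted.\<close>

lemma card_normal_colorings:
  "real (card (normal_colorings q K5)) = 1"
  "real (card (normal_colorings q K33)) = 1"
  "real (card (normal_colorings q K5_minus)) = real q * (real q + 1) / 2"
  "real (card (normal_colorings q K4)) = real q ^ 2"
  "real (card (normal_colorings q K33_minus)) = real q * (real q + 1) / 2"
  "real (card (normal_colorings q K23)) = real q ^ 2"
  "real (card (normal_colorings q C4)) = real q * (real q - 1) / 2"
  "real (card (normal_colorings q K3)) = real q * (real q - 1) / 2"
  "real (card (normal_colorings q K13)) = real q * (real q - 1) / 2"
  "real (card (normal_colorings q K1)) = real q * (real q - 1) * (real q - 2) / 6"
  "real (card (normal_colorings q TwoK1)) = real q * (real q - 1) * (real q - 2) * (real q - 3) / 8"
  unfolding normal_colorings.simps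
  by (simp, simp,
    subst card_image, force simp: inj_on_def, rule card_le_pairs,
    subst card_image, force simp: inj_on_def, simp add: power2_eq_square,
    subst card_image, force simp: inj_on_def, rule card_le_pairs,
    subst card_image, force simp: inj_on_def, simp add: power2_eq_square,
    subst card_image, force simp: inj_on_def, rule card_less_pairs,
    subst card_image, force simp: inj_on_def, simp only: card_subsets real_choose,
    subst card_image, force simp: inj_on_def, simp only: card_subsets real_choose,
    subst card_image, force simp: inj_on_def, simp only: card_subsets real_choose,
    subst card_image, force simp: inj_on_def, rule card_disjoint_pairs)

theorem mainTheorem2:
  fixes q :: nat
  shows "real (card (Obs_classes q)) =
    1 / 24 * (3 * real q ^ 4 - 14 * real q ^ 3 + 129 * real q ^ 2 - 22 * real q + 48)"
proof -
  have "card (normal_codes q) = (\<Sum>s\<in>UNIV. card (normal_colorings q s))"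
    unfolding normal_codes_def using finite_normal_colorings
    by (intro card_SigmaI) (simp_all add: UNIV_shape)
  \<comment> \<open>All summands are written as polynomials in \<open>real q\<close>, so that only a
    polynomial identity remains.\<close>
  then have "real (card (normal_codes q)) = 2 + real q * (real q + 1) + 2 * real q ^ 2 + 3 * (real q * (real q - 1) / 2)
     + real q * (real q - 1) * (real q - 2) / 6 + real q * (real q - 1) * (real q - 2) * (real q - 3) / 8"
    by (simp add: UNIV_shape card_normal_colorings del: normal_colorings.simps)
  then show ?thesis unfolding card_Obs_classes
    by (simp add: field_simps power2_eq_square power3_eq_cube power4_eq_xxxx)
qed

end
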